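(* Let $WT$ be the collection of all weakly thinnable pairs, and let $WTC$ be the collection of all $(\mathcal{F},\mu)\in WT$ such that $\mu$ is coherent. Let $$\mathcal{A}^{\mathrm{uni}}=\left\{A\in\mathcal{M} : \exists L\ \ \lim_{D\to\infty}\ \sup_{x\in(1,\infty)}\left|\frac{1}{\log(D)}\int_x^{xD}\frac{1_A(y)}{y}\,\mathrm{d}y-L\right|=0\right\}$$ and, for $A\in\mathcal{A}^{\mathrm{uni}}$, $$\alpha(A)=\lim_{D\to\infty}\frac{1}{\log(D)}\int_1^{D}\frac{1_A(y)}{y}\,\mathrm{d}y .$$ Then the following holds: 1. The pair $(\mathcal{A}^{\mathrm{uni}},\alpha)$ is a weakly thinnable pair; it is extendable to a weakly thinnable pair $(\mathcal{F},\mu)$ with $\mathcal{F}=\mathcal{M}$, i.e. there is $\mu:\mathcal{M}\to[0,1]$ with $(\mathcal{M},\mu)\in WT$ and $\mu(A)=\alpha(A)$ for all $A\in\mathcal{A}^{\mathrm{uni}}$; and $\alpha$ is coherent. 2. The pair $(\mathcal{A}^{\mathrm{uni}},\alpha)$ is canonical with respect to both $WT$ and $WTC$. 3. If a pair $(\mathcal{F},\mu)$ is canonical with respect to $WT$ or $WTC$, then $\mathcal{F}\subseteq\mathcal{A}^{\mathrm{uni}}$.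
   Context: All sets are subsets of $[0,\infty)$; $m$ is Lebesgue measure and $1_A$ is the indicator function of $A$. The collection $\mathcal{M}$: $\mathcal{M}:=\left\{\bigcup_{i=1}^\infty[a_{2i-1},a_{2i}) : 0\le a_1\le a_2\le a_3\le\cdots\right\}$. (The paper states that $\mathcal{M}$ is an algebra on $[0,\infty)$.) $f$-systems and probability pairs (on $[0,\infty)$): An $f$-system is a nonempty collection $\mathcal{F}$ of subsets of $[0,\infty)$ such that (i) $A,B\in\mathcal{F}$ with $A\cap B=\emptyset$ implies $A\cup B\in\mathcal{F}$, and (ii) $A\in\mathcal{F}$ implies $A^c\in\mathcal{F}$. A probability measure on an $f$-system $\mathcal{F}$ is a map $\mu:\mathcal{F}\to[0,1]$ with $\mu([0,\infty))=1$ and $\mu(A\cup B)=\mu(A)+\mu(B)$ for all disjoint $A,B\in\mathcal{F}$. A probability pair is a pair $(\mathcal{F},\mu)$ with $\mathcal{F}$ an $f$-system and $\mu$ a probability measure on $\mathcal{F}$. The measure $\mu$ is coherent if for all $n\in\mathbb{N}$, $\alpha_1,\dots,\alpha_n\in\mathbb{R}$ and $A_1,\dots,A_n\in\mathcal{F}$ one has $\sup_{x\in[0,\infty)}\sum_{i=1}^n\alpha_i(1_{A_i}(x)-\mu(A_i))\ge0$. Density: for $A\in\mathcal{M}$ let $\rho_A(0):=0$ and $\rho_A(x):=\frac1x\int_0^x1_A(y)\,\mathrm{d}y$ for $x>0$. Let $\mathcal{C}:=\{A\in\mathcal{M}:\rho_A(x)\text{ converges as }x\to\infty\}$. Thinning: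 for $A\in\mathcal{M}$ let $S_A(x):=m(A\cap[0,x))$ for $x\ge 0$. For $A,B\in\mathcal{M}$ let $A\circ B:=\{x\in[0,\infty):x\in A\text{ and }S_A(x)\in B\}$. Weakly thinnable pair (WTP): a probability pair $(\mathcal{F},\mu)$ with $\mathcal{F}\subseteq\mathcal{M}$ such that (P1) for every $C\in\mathcal{C}$ and $A\in\mathcal{F}$ we have $C\circ A\in\mathcal{F}$ and $\mu(C\circ A)=\mu(C)\mu(A)$ (in particular $\mathcal{C}\subseteq\mathcal{F}$, taking $A=[0,\infty)$); (P2) $\mu$ preserves ordering by $S$: if $A,B\in\mathcal{F}$ and $S_A(x)\ge S_B(x)$ for every $x\in[0,\infty)$, then $\mu(A)\ge\mu(B)$; (P3) $\mu([c,\infty))=1$ for every $c\in[0,\infty)$. Canonical: for a collection $P$ of probability pairs, a pair $(\mathcal{F},\mu)\in P$ is canonical with respect to $P$ if for every $A\in\mathcal{F}$ and every $(\mathcal{F}',\mu')\in P$ with $A\in\mathcal{F}'$ we have $\mu(A)=\mu'(A)$.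
   Formalization: In the definition of M the endpoints a_i are required to tend to infinity; if bounded sequences were allowed, M and A^uni would not be closed under complement and no weakly thinnable pair would exist. *)

theory Defs
  imports "HOL-Analysis.Analysis"
begin

text \<open>
  All sets under consideration are subsets of \<open>{0..}\<close>, and complements are taken relative to
  \<open>{0..}\<close>. A set function on a collection \<open>F\<close> is a total function of type
  \<open>real set \<Rightarrow> real\<close> whose values outside \<open>F\<close> are never referred to.

  The endpoints of the intervals tend to infinity. Without this requirement the collection is not
  closed under complements: for \<open>a\<^sub>i = 1 - 1 / (i + 1)\<close> the intervals and the gaps between them
  both accumulate at 1, and the complement contains \<open>{1..}\<close> beyond infinitely many intervals.
  With it one gets exactly the sets of the form \<open>\<Union>[a\<^sub>2\<^sub>i, a\<^sub>2\<^sub>i\<^sub>+\<^sub>1)\<close>, \<open>a\<close> nondecreasing,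
  whose complement is again of that form. Bounded sets are not excluded, since intervals may
  be empty.
\<close>

definition MM :: "real set set" where
  "MM = {(\<Union>i. {a (2 * i) ..< a (2 * i + 1)}) | a :: nat \<Rightarrow> real.
           0 \<le> a 0 \<and> incseq a \<and> filterlim a at_top sequentially}"

definition f_system :: "real set set \<Rightarrow> bool" where
  "f_system F \<longleftrightarrow>
     F \<noteq> {} \<and> F \<subseteq> Pow {0..} \<and>
     (\<forall>A\<in>F. \<forall>B\<in>F. A \<inter> B = {} \<longrightarrow> A \<union> B \<in> F) \<and>
     (\<forall>A\<in>F. {0..} - A \<in> F)"

definition probability_measure_on :: "real set set \<Rightarrow> (real set \<Rightarrow> real) \<Rightarrow> bool" where
  "probability_measure_on F \<mu> \<longleftrightarrow>
     (\<forall>A\<in>F. \<mu> A \<in> {0..1}) \<and> \<mu> {0..} = 1 \<and>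
     (\<forall>A\<in>F. \<forall>B\<in>F. A \<inter> B = {} \<longrightarrow> \<mu> (A \<union> B) = \<mu> A + \<mu> B)"

definition probability_pair :: "real set set \<times> (real set \<Rightarrow> real) \<Rightarrow> bool" where
  "probability_pair = (\<lambda>(F, \<mu>). f_system F \<and> probability_measure_on F \<mu>)"

text \<open>The supremum below is over a bounded nonempty set, as the function is a finite sum of
  indicators up to constants.\<close>

definition coherent :: "real set set \<Rightarrow> (real set \<Rightarrow> real) \<Rightarrow> bool" where
  "coherent F \<mu> \<longleftrightarrow>
     (\<forall>(n::nat) (c :: nat \<Rightarrow> real) (A :: nat \<Rightarrow> real set).
        (\<forall>i\<in>{1..n}. A i \<in> F) \<longrightarrow>
        (SUP x\<in>{0..}. \<Sum>i = 1..n. c i * (indicator (A i) x - \<mu> (A i))) \<ge> 0)"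

definition rho :: "real set \<Rightarrow> real \<Rightarrow> real" where
  "rho A x = (if x = 0 then 0 else (1 / x) * (LINT y:{0..x}|lborel. indicator A y))"

definition CC :: "real set set" where
  "CC = {A \<in> MM. \<exists>l. (rho A \<longlongrightarrow> l) at_top}"

definition S :: "real set \<Rightarrow> real \<Rightarrow> real" where
  "S A x = measure lborel (A \<inter> {0..<x})"

definition thin :: "real set \<Rightarrow> real set \<Rightarrow> real set" where
  "thin A B = {x \<in> {0..}. x \<in> A \<and> S A x \<in> B}"

definition WT :: "(real set set \<times> (real set \<Rightarrow> real)) set" where
  "WT = {(F, \<mu>). probability_pair (F, \<mu>) \<and> F \<subseteq> MM \<and>
     (\<forall>C\<in>CC. \<forall>A\<in>F. thin C A \<in> F \<and> \<mu> (thin C A) = \<mu> C * \<mu> A) \<and>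
     (\<forall>A\<in>F. \<forall>B\<in>F. (\<forall>x\<in>{0..}. S A x \<ge> S B x) \<longrightarrow> \<mu> A \<ge> \<mu> B) \<and>
     (\<forall>c\<ge>0. \<mu> {c..} = 1)}"

definition WTC :: "(real set set \<times> (real set \<Rightarrow> real)) set" where
  "WTC = {(F, \<mu>) \<in> WT. coherent F \<mu>}"

definition canonical ::
  "(real set set \<times> (real set \<Rightarrow> real)) set \<Rightarrow> real set set \<times> (real set \<Rightarrow> real) \<Rightarrow> bool" where
  "canonical P = (\<lambda>(F, \<mu>). (F, \<mu>) \<in> P \<and>
     (\<forall>A\<in>F. \<forall>(F', \<mu>')\<in>P. A \<in> F' \<longrightarrow> \<mu> A = \<mu>' A))"

definition log_avg :: "real set \<Rightarrow> real \<Rightarrow> real \<Rightarrow> real" where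
  "log_avg A x D = (1 / ln D) * (LINT y:{x..x * D}|lborel. indicator A y / y)"

text \<open>For \<open>D > 1\<close> the values of \<open>log_avg A x D\<close> lie in \<open>{0..1}\<close>, so the supremum below is over a
  bounded set for all \<open>D\<close> relevant to the limit.\<close>

definition Auni :: "real set set" where
  "Auni = {A \<in> MM. \<exists>L. ((\<lambda>D. SUP x\<in>{1<..}. \<bar>log_avg A x D - L\<bar>) \<longlongrightarrow> 0) at_top}"

definition alpha :: "real set \<Rightarrow> real" where
  "alpha A = Lim at_top (log_avg A 1)"

end

theory Submission
  imports Defs
begin

text \<open>
Everything is expressed through the counting function \<open>S A\<close>. Two facts drive the proof.
Thinning is composition, \<open>S (thin C A) = S A \<circ> S C\<close> (\<open>S_thin\<close>), so thinning by a set of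
density \<open>c\<close> rescales \<open>S A\<close> by the factor \<open>c\<close> in the argument, up to a sublinear error.
Integration by parts turns \<open>ln D\<close> times the logarithmic average into the integral of
\<open>S A u / u\<^sup>2\<close> up to a bounded error (\<open>log_avg_eq\<close>), and that integral is invariant under
scaling of the argument up to the factor \<open>c\<close> and a bounded shift of the limits. Hence
logarithmic averages over windows \<open>[x, x D]\<close> are asymptotically multiplicative under
thinning as \<open>D\<close> grows, uniformly in \<open>x\<close> (\<open>log_avg_thin\<close>).

Consequently, if the averages of all sets of an f-system that is closed under thinning
converge along some proper filter of windows with \<open>D \<longrightarrow> \<infinity>\<close>, the limits form a coherent weakly
thinnable pair (\<open>limit_pair_in_WTC\<close>). Taking all windows gives \<open>(Auni, alpha)\<close>. Tychonoff's
theorem refines every proper filter of windows to one along which the averages of all sets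
of \<open>MM\<close> converge, which gives pairs defined on all of \<open>MM\<close>. If \<open>A\<close> is not in \<open>Auni\<close>, two such
refinements assign different values to \<open>A\<close> (\<open>not_Auni_two_pairs\<close>), so no canonical pair can
contain \<open>A\<close>.

It remains to see that every weakly thinnable pair \<open>(F, \<mu>)\<close> agrees with \<open>alpha\<close> on \<open>F \<inter> Auni\<close>.
Ordering by \<open>S\<close> bounds \<open>\<mu> A\<close> by any \<open>c\<close> with \<open>S A x \<le> c x + K\<close> (\<open>\<mu>_le_growth_rate\<close>). For
\<open>A \<in> F \<inter> Auni\<close> this is applied not to \<open>A\<close> but to a disjoint union of thinnings of \<open>A\<close> with
densities proportional to \<open>1/2, 1/3, \<dots>, 1/N\<close>. This mixture has almost the same measure as \<open>A\<close>,
while its counting function at \<open>y\<close> is, up to a constant, a lower sum for \<open>y\<close> times the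
logarithmic average of \<open>A\<close> over the window of ratio \<open>N\<close> ending at \<open>y / ln N\<close> (\<open>harmonic_mixture\<close>).
So \<open>\<mu> A\<close> is at most the uniform limit of these averages, and passing to complements gives
equality.
\<close>

section \<open>Sets with locally finite boundary\<close>

text \<open>
A locally finite set \<open>D\<close> off which membership in \<open>A\<close> does not change; the half-open interval
\<open>{x<..y}\<close> reflects that indicators of sets in \<open>MM\<close> are right-continuous. \<open>D\<close> may be larger than
the boundary of \<open>A\<close>, so that the union of jump sets of \<open>A\<close> and \<open>B\<close> serves both sets at once.
\<close>
definition jump_set :: "real set \<Rightarrow> real set \<Rightarrow> bool" where
  "jump_set D A \<longleftrightarrow> (\<forall>R. finite (D \<inter> {..R})) \<and>
     (\<forall>x y. 0 \<le> x \<and> x \<le> y \<and> D \<inter> {x<..y} = {} \<longrightarrow> (x \<in> A \<longleftrightarrow> y \<in> A))"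

lemma jump_set_finite: "jump_set D A \<Longrightarrow> finite (D \<inter> {..R})"
  by (simp add: jump_set_def)

lemma jump_set_constant:
  "jump_set D A \<Longrightarrow> 0 \<le> x \<Longrightarrow> x \<le> y \<Longrightarrow> D \<inter> {x<..y} = {} \<Longrightarrow> x \<in> A \<longleftrightarrow> y \<in> A"
  unfolding jump_set_def by blast

text \<open>
Each point is followed by the least element of \<open>E\<close> beyond it. The natural numbers guarantee
that there is one, at distance at most 1; local finiteness makes the minimum exist and
keeps the sequence from accumulating.
\<close>
lemma locally_finite_enumeration:
  fixes E :: "real set"
  assumes fin: "\<And>R. finite (E \<inter> {..R})" and nat: "\<nat> \<subseteq> E"
  obtains d :: "nat \<Rightarrow> real" where "d 0 = 0" "strict_mono d" "filterlim d at_top sequentially"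
    "\<And>n. E \<inter> {d n<..<d (Suc n)} = {}"
proof -
  define nxt where "nxt x = Min (E \<inter> {x<..x + 1})" for x
  have fin': "finite (E \<inter> {x<..x + 1})" for x
    by (rule finite_subset[OF _ fin[of "x + 1"]]) auto
  have ne: "E \<inter> {x<..x + 1} \<noteq> {}" if "0 \<le> x" for x
  proof -
    have "real (nat \<lfloor>x\<rfloor> + 1) \<in> E" using nat of_nat_in_Nats by blast
    moreover have "real (nat \<lfloor>x\<rfloor> + 1) \<in> {x<..x + 1}" using that by simp linarith
    ultimately show ?thesis by blast
  qed
  have nxt: "nxt x \<in> E" "x < nxt x" "E \<inter> {x<..<nxt x} = {}" if "0 \<le> x" for x
  proof -
    have *: "nxt x \<in> E \<inter> {x<..x + 1}"
      unfolding nxt_def by (rule Min_in[OF fin' ne[OF that]])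
    then show "nxt x \<in> E" "x < nxt x" by auto
    show "E \<inter> {x<..<nxt x} = {}"
    proof (rule ccontr)
      assume "E \<inter> {x<..<nxt x} \<noteq> {}"
      then obtain e where e: "e \<in> E" "x < e" "e < nxt x" by auto
      then have "e \<in> E \<inter> {x<..x + 1}" using * by auto
      then have "nxt x \<le> e" unfolding nxt_def by (rule Min_le[OF fin'])
      with e show False by simp
    qed
  qed
  define d where "d n = (nxt ^^ n) 0" for n
  have d0: "d 0 = 0" by (simp add: d_def)
  have dS: "d (Suc n) = nxt (d n)" for n by (simp add: d_def)
  have dpos: "0 \<le> d n" for n
    by (induction n) (auto simp: d0 dS intro: order.trans less_imp_le nxt(2))
  have sm: "strict_mono d"
    unfolding strict_mono_Suc_iff using nxt(2) dpos dS by simp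
  have "filterlim d at_top sequentially"
  proof -
    have "\<exists>n. R < d n" for R
    proof (rule ccontr)
      assume "\<nexists>n. R < d n"
      then have "range (\<lambda>n. d (Suc n)) \<subseteq> E \<inter> {..R}"
        using nxt(1)[OF dpos] by (auto simp: not_less simp flip: dS)
      then have "finite (range (\<lambda>n. d (Suc n)))" using fin finite_subset by blast
      moreover have "inj (\<lambda>n. d (Suc n))"
        using strict_mono_imp_inj_on[OF sm] by (auto simp: inj_def)
      ultimately show False using finite_imageD by blast
    qed
    then show ?thesis
      unfolding filterlim_at_top_dense eventually_sequentially
      by (meson sm order_less_le_trans strict_mono_less_eq)
  qed
  then show ?thesis using that[of d] d0 sm nxt(3) dpos dS by metis
qed

text \<open>
In contrast to the endpoint sequences that define \<open>MM\<close>, jump sets are easily combined, which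
makes the closure properties of \<open>MM\<close> immediate.
\<close>
lemma MM_iff: "A \<in> MM \<longleftrightarrow> A \<subseteq> {0..} \<and> (\<exists>D. jump_set D A)"
proof
  assume "A \<in> MM"
  then obtain a where A: "A = (\<Union>i. {a (2 * i) ..< a (2 * i + 1)})" and a0: "0 \<le> a 0"
    and inc: "incseq a" and lim: "filterlim a at_top sequentially"
    unfolding MM_def by blast
  have anon: "0 \<le> a i" for i using a0 inc incseqD[OF inc, of 0 i] by simp
  have "jump_set (range a) A"
    unfolding jump_set_def
  proof (intro conjI allI impI)
    fix R
    obtain n where "\<And>i. n \<le> i \<Longrightarrow> R < a i"
      using lim unfolding filterlim_at_top_dense eventually_sequentially by blast
    then have "range a \<inter> {..R} \<subseteq> a ` {..<n}" by (force simp: not_less[symmetric])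
    then show "finite (range a \<inter> {..R})" by (rule finite_subset) simp
  next
    fix x y :: real assume *: "0 \<le> x \<and> x \<le> y \<and> range a \<inter> {x<..y} = {}"
    have "x < a i \<longleftrightarrow> y < a i" for i using * by force
    then show "x \<in> A \<longleftrightarrow> y \<in> A" unfolding A by (simp add: linorder_not_less[symmetric])
  qed
  then show "A \<subseteq> {0..} \<and> (\<exists>D. jump_set D A)"
    using order_trans[OF anon] unfolding A by auto
next
  assume "A \<subseteq> {0..} \<and> (\<exists>D. jump_set D A)"
  then obtain D where A0: "A \<subseteq> {0..}" and D: "jump_set D A" by blast
  have finN: "finite (\<nat> \<inter> {..R})" for R :: real
  proof (rule finite_subset)
    show "\<nat> \<inter> {..R} \<subseteq> real ` {..nat \<lceil>R\<rceil>}"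
      by (auto elim!: Nats_cases intro!: imageI) linarith
  qed simp
  have "finite ((D \<union> \<nat>) \<inter> {..R})" for R
    using jump_set_finite[OF D, of R] finN[of R] by (simp add: Int_Un_distrib2)
  then obtain d where d0: "d 0 = 0" and dsm: "strict_mono d"
    and dlim: "filterlim d at_top sequentially" and dgap: "\<And>n. (D \<union> \<nat>) \<inter> {d n<..<d (Suc n)} = {}"
    using locally_finite_enumeration[of "D \<union> \<nat>"] by blast
  have dpos: "0 \<le> d n" for n using d0 strict_mono_less_eq[OF dsm, of 0 n] by simp
  have dSuc: "d n < d (Suc n)" for n using dsm by (simp add: strict_mono_Suc_iff)
  \<comment> \<open>The gap after \<open>d i\<close> is kept as an interval if it lies in \<open>A\<close> and collapsed to an empty one otherwise.\<close>
  define a where "a n = (if even n then d (n div 2)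
      else if d (n div 2) \<in> A then d (Suc (n div 2)) else d (n div 2))" for n
  have ae: "a (2 * i) = d i" and ao: "a (2 * i + 1) = (if d i \<in> A then d (Suc i) else d i)" for i
    unfolding a_def by auto
  have inc: "incseq a"
  proof (rule incseq_SucI)
    fix n show "a n \<le> a (Suc n)"
    proof (cases "even n")
      case True
      then obtain i where "n = 2 * i" by blast
      then show ?thesis using ae[of i] ao[of i] dSuc[of i] by auto
    next
      case False
      then obtain i where n: "n = 2 * i + 1" using oddE by blast
      have "a (Suc n) = d (Suc i)" using ae[of "Suc i"] n by simp
      then show ?thesis using ao[of i] dSuc[of i] n by auto
    qed
  qed
  have low: "d (n div 2) \<le> a n" for n using dSuc[of "n div 2"] by (auto simp: a_def)
  have lim: "filterlim a at_top sequentially"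
  proof (rule filterlim_at_top_mono)
    have "filterlim (\<lambda>n::nat. n div 2) sequentially sequentially"
      by (rule filterlim_at_top_div_const_nat) simp
    then show "filterlim (\<lambda>n. d (n div 2)) at_top sequentially"
      by (rule filterlim_compose[OF dlim])
    show "eventually (\<lambda>n. d (n div 2) \<le> a n) sequentially" using low by simp
  qed
  have loc: "\<exists>i. d i \<le> x \<and> x < d (Suc i)" if "0 \<le> x" for x
  proof -
    obtain n where "x < d n"
      using dlim unfolding filterlim_at_top_dense eventually_sequentially by blast
    then show ?thesis
    proof (induction n)
      case 0 then show ?case using that d0 by simp
    next
      case (Suc n) then show ?case using not_less by blast
    qed
  qed
  have const: "x \<in> A \<longleftrightarrow> d i \<in> A" if "d i \<le> x" "x < d (Suc i)" for x i
    by (rule jump_set_constant[OF D, symmetric]) (use that dpos dgap[of i] in auto)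
  have "A = (\<Union>i. {a (2 * i) ..< a (2 * i + 1)})"
  proof (intro equalityI subsetI)
    fix x assume x: "x \<in> A"
    then obtain i where "d i \<le> x" "x < d (Suc i)" using loc A0 by fastforce
    then show "x \<in> (\<Union>i. {a (2 * i) ..< a (2 * i + 1)})"
      using const x unfolding ae ao by (intro UN_I[of i]) auto
  next
    fix x assume "x \<in> (\<Union>i. {a (2 * i) ..< a (2 * i + 1)})"
    then obtain i where "d i \<le> x" "x < (if d i \<in> A then d (Suc i) else d i)"
      unfolding ae ao by auto
    then show "x \<in> A" using const[of i x] by (auto split: if_splits)
  qed
  moreover have "0 \<le> a 0" using ae[of 0] d0 by simp
  ultimately show "A \<in> MM" unfolding MM_def using inc lim by blast
qed

lemma MM_I: "A \<subseteq> {0..} \<Longrightarrow> jump_set D A \<Longrightarrow> A \<in> MM"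
  using MM_iff by blast

lemma MM_nonneg: "A \<in> MM \<Longrightarrow> A \<subseteq> {0..}"
  using MM_iff by blast

lemma MM_borel: "A \<in> MM \<Longrightarrow> A \<in> sets borel"
  unfolding MM_def by auto

lemma MM_Un: assumes "A \<in> MM" "B \<in> MM" shows "A \<union> B \<in> MM"
proof -
  obtain D E where "jump_set D A" "jump_set E B" using assms MM_iff by blast
  then have "jump_set (D \<union> E) (A \<union> B)"
    unfolding jump_set_def by (auto simp: Int_Un_distrib2)
  then show ?thesis by (rule MM_I[rotated]) (use assms MM_nonneg in auto)
qed

lemma MM_Compl: assumes "A \<in> MM" shows "{0..} - A \<in> MM"
proof -
  obtain D where "jump_set D A" using assms MM_iff by blast
  then have "jump_set D ({0..} - A)"
    unfolding jump_set_def by auto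
  then show ?thesis by (rule MM_I[rotated]) auto
qed

lemma MM_atLeast: "0 \<le> c \<Longrightarrow> {c..} \<in> MM"
  by (rule MM_I[of _ "{c}"]) (auto simp: jump_set_def)

lemma MM_right_neighbourhood:
  assumes "A \<in> MM" "x \<in> A" obtains e where "0 < e" "{x..<x + e} \<subseteq> A"
proof -
  obtain D where D: "jump_set D A" using assms MM_iff by blast
  have x0: "0 \<le> x" using assms MM_nonneg by auto
  have "finite (D \<inter> {x<..x + 1})"
    by (rule finite_subset[OF _ jump_set_finite[OF D, of "x + 1"]]) auto
  then obtain e where e: "0 < e" "\<And>d. d \<in> D \<inter> {x<..x + 1} \<Longrightarrow> d \<noteq> x \<Longrightarrow> e \<le> dist x d"
    using finite_set_avoid[of "D \<inter> {x<..x + 1}" x] by auto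
  have "y \<in> A" if "x \<le> y" "y < x + min e 1" for y
  proof -
    have "D \<inter> {x<..y} = {}" using e(2) that by (force simp: dist_real_def)
    then show ?thesis using jump_set_constant[OF D x0 that(1)] assms by simp
  qed
  then show ?thesis by (intro that[of "min e 1"]) (use e(1) in auto)
qed

section \<open>The counting function and thinning\<close>


lemma S_nonneg: "0 \<le> S A x" by (simp add: S_def)

lemma S_0 [simp]: "S A 0 = 0" by (simp add: S_def)

lemma fmeasurable_S_piece:
  assumes "A \<in> sets borel" shows "A \<inter> {x..<y::real} \<in> fmeasurable lborel"
proof (rule fmeasurableI2)
  show "{x..<y} \<in> fmeasurable lborel" by (cases "x \<le> y") (auto intro: fmeasurableI)
qed (use assms in auto)

lemma S_add:
  assumes "A \<in> sets borel" "0 \<le> x" "x \<le> y"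
  shows "S A y = S A x + measure lborel (A \<inter> {x..<y})"
proof -
  have "A \<inter> {0..<y} = (A \<inter> {0..<x}) \<union> (A \<inter> {x..<y})" using assms by auto
  then show ?thesis unfolding S_def
    by (simp add: measure_Un_AE measure_Un3[OF fmeasurable_S_piece[OF assms(1)] fmeasurable_S_piece[OF assms(1)]])
       (metis (no_types, lifting) Int_assoc Int_left_commute disjoint_iff atLeastLessThan_iff leD Int_iff measure_empty)
qed

lemma S_mono: "A \<in> sets borel \<Longrightarrow> 0 \<le> x \<Longrightarrow> x \<le> y \<Longrightarrow> S A x \<le> S A y"
  using S_add[of A x y] by simp

lemma S_increment_le:
  assumes "A \<in> sets borel" "0 \<le> x" "x \<le> y" shows "S A y - S A x \<le> y - x"
proof -
  have "measure lborel (A \<inter> {x..<y}) \<le> measure lborel {x..<y}"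
    by (rule measure_mono_fmeasurable) (use assms fmeasurable_S_piece[of UNIV] in auto)
  then show ?thesis using S_add[OF assms] assms by simp
qed

lemma S_le: "A \<in> sets borel \<Longrightarrow> 0 \<le> x \<Longrightarrow> S A x \<le> x"
  using S_increment_le[of A 0 x] by simp

lemma S_lipschitz:
  "A \<in> sets borel \<Longrightarrow> 0 \<le> x \<Longrightarrow> 0 \<le> y \<Longrightarrow> \<bar>S A x - S A y\<bar> \<le> \<bar>x - y\<bar>"
  using S_increment_le[of A x y] S_increment_le[of A y x] S_mono[of A x y] S_mono[of A y x]
  by (cases "x \<le> y") auto

lemma continuous_on_S: "A \<in> sets borel \<Longrightarrow> continuous_on {0..} (S A)"
  by (rule lipschitz_on_continuous_on[of 1])
     (auto intro!: lipschitz_onI simp: dist_real_def S_lipschitz)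

lemma S_Un:
  assumes "A \<in> sets borel" "B \<in> sets borel" "A \<inter> B = {}"
  shows "S (A \<union> B) x = S A x + S B x"
proof -
  have "(A \<union> B) \<inter> {0..<x} = (A \<inter> {0..<x}) \<union> (B \<inter> {0..<x})" by auto
  moreover have "(A \<inter> {0..<x}) \<inter> (B \<inter> {0..<x}) = {}" using assms by auto
  ultimately show ?thesis unfolding S_def
    by (simp add: measure_Un3[OF fmeasurable_S_piece fmeasurable_S_piece] assms)
qed

lemma S_atLeast_0: "0 \<le> x \<Longrightarrow> S {0..} x = x"
proof -
  assume "0 \<le> x"
  moreover have "{0..} \<inter> {0..<x} = {0..<x}" by auto
  ultimately show ?thesis by (simp add: S_def)
qed

lemma S_Compl:
  assumes "A \<in> sets borel" "A \<subseteq> {0..}" "0 \<le> x"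
  shows "S ({0..} - A) x = x - S A x"
proof -
  have "S (A \<union> ({0..} - A)) x = S A x + S ({0..} - A) x" by (rule S_Un) (use assms in auto)
  moreover have "A \<union> ({0..} - A) = {0..}" using assms by auto
  ultimately show ?thesis using S_atLeast_0[OF assms(3)] by simp
qed

lemma S_eq_increment_interval:
  assumes "A \<in> sets borel" "0 \<le> x" "x \<le> y" "{x..<y} \<subseteq> A"
  shows "S A y = S A x + (y - x)"
proof -
  have "A \<inter> {x..<y} = {x..<y}" using assms by auto
  then show ?thesis using S_add[OF assms(1-3)] assms by simp
qed

text \<open>
A point of \<open>C\<close> is the left end of an interval contained in \<open>C\<close>, on which \<open>S C\<close> has slope 1.
\<close>
lemma S_strict_mono_on: assumes "C \<in> MM" shows "strict_mono_on C (S C)"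
proof (rule strict_mono_onI)
  fix x y assume *: "x \<in> C" "y \<in> C" "x < y"
  have x0: "0 \<le> x" using * assms MM_nonneg by auto
  obtain e where e: "0 < e" "{x..<x + e} \<subseteq> C" using MM_right_neighbourhood assms * by blast
  define z where "z = min y (x + e)"
  have "S C z = S C x + (z - x)"
    by (rule S_eq_increment_interval) (use assms MM_borel x0 * e z_def in auto)
  moreover have "S C z \<le> S C y"
    by (rule S_mono) (use assms MM_borel x0 * e z_def in auto)
  ultimately show "S C x < S C y" using e * unfolding z_def by auto
qed

lemma S_measurable [measurable]:
  assumes "C \<in> sets borel" shows "S C \<in> borel_measurable borel"
proof (rule borel_measurable_mono)
  show "mono (S C)"
    unfolding S_def using assms fmeasurable_S_piece[OF assms, of 0]
    by (intro monoI measure_mono_fmeasurable) auto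
qed

text \<open>
The map \<open>S C\<close> flattens the complement of \<open>C\<close> and moves the pieces of \<open>C\<close> together, so it carries
Lebesgue measure on \<open>C \<inter> {0..<x}\<close> to Lebesgue measure on \<open>{0..<S C x}\<close>. It suffices to compare
the two measures on the half-lines \<open>{s<..}\<close>.
\<close>
lemma S_thin:
  assumes C: "C \<in> sets borel" and A: "A \<in> sets borel" and x: "0 \<le> x"
  shows "S (thin C A) x = S A (S C x)"
proof -
  define K where "K = C \<inter> {0..<x}"
  note C[measurable] A[measurable] S_measurable[OF C, measurable]
  have K[measurable]: "K \<in> sets borel" unfolding K_def by auto
  define M where "M = distr (density lborel (indicator K)) borel (S C)"
  define N where "N = density lborel (indicator {0..<S C x} :: real \<Rightarrow> ennreal)"
  have M: "emeasure M E = emeasure lborel (K \<inter> S C -` E)" if "E \<in> sets borel" for E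
  proof -
    have "S C -` E \<in> sets borel"
      using measurable_sets[OF S_measurable[OF C] that] by simp
    then show ?thesis unfolding M_def using that
      by (simp add: emeasure_distr emeasure_density flip: indicator_inter_arith)
  qed
  have N: "emeasure N E = emeasure lborel ({0..<S C x} \<inter> E)" if "E \<in> sets borel" for E
    unfolding N_def using that by (simp add: emeasure_density flip: indicator_inter_arith)
  have SK: "emeasure lborel (C \<inter> {0..<y}) = ennreal (S C y)" for y
    unfolding S_def using fmeasurable_S_piece[OF C, of 0 y]
    by (simp add: emeasure_eq_measure2 fmeasurableD2)
  have "M = N"
  proof (rule measure_eqI_lessThan)
    show "sets M = sets borel" "sets N = sets borel" by (simp_all add: M_def N_def)
    fix s :: real
    have "emeasure M {s<..} \<le> emeasure lborel (C \<inter> {0..<x})"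
      by (subst M) (auto intro!: emeasure_mono simp: K_def)
    then show "emeasure M {s<..} < \<infinity>" using SK by (simp add: order_le_less_trans)
    consider "s < 0" | "S C x \<le> s" | "0 \<le> s" "s \<le> S C x" by linarith
    then show "emeasure M {s<..} = emeasure N {s<..}"
    proof cases
      case 1
      then have "K \<inter> S C -` {s<..} = C \<inter> {0..<x}" "{0..<S C x} \<inter> {s<..} = {0..<S C x}"
        using S_nonneg[of C] by (auto simp: K_def intro: less_le_trans)
      then show ?thesis using S_nonneg[of C x] by (simp add: M N SK)
    next
      case 2
      have "K \<inter> S C -` {s<..} = {}" "{0..<S C x} \<inter> {s<..} = {}"
        using 2 S_mono[OF C, of _ x] by (force simp: K_def)+
      then show ?thesis by (simp add: M N)
    next
      case 3
      \<comment> \<open>The last point at which \<open>S C\<close> takes the value \<open>s\<close>: beyond it \<open>S C\<close> exceeds \<open>s\<close>.\<close>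
      define Z where "Z = {0..x} \<inter> S C -` {s}"
      have cont: "continuous_on {0..x} (S C)"
        by (rule continuous_on_subset[OF continuous_on_S[OF C]]) auto
      have "closed Z" unfolding Z_def
        by (rule continuous_closed_preimage[OF cont]) auto
      then have "compact Z"
        by (auto simp: compact_eq_bounded_closed Z_def intro: bounded_subset[of "{0..x}"])
      moreover have "Z \<noteq> {}" using IVT'[of "S C" 0 s x, OF _ _ _ cont] 3 x by (auto simp: Z_def)
      ultimately obtain z where z: "z \<in> Z" "\<And>y. y \<in> Z \<Longrightarrow> y \<le> z"
        using compact_attains_sup[of Z] by blast
      have z': "0 \<le> z" "z \<le> x" "S C z = s" using z(1) by (auto simp: Z_def)
      have "s < S C y \<longleftrightarrow> z < y" if "0 \<le> y" "y < x" for y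
        using S_mono[OF C, of y z] S_mono[OF C, of z y] z(2)[of y] z' that
        by (cases "y \<le> z") (auto simp: Z_def less_le)
      then have "K \<inter> S C -` {s<..} = C \<inter> {z<..<x}"
        using z' by (auto simp: K_def)
      then have "emeasure M {s<..} = emeasure lborel (C \<inter> {z<..<x})" by (simp add: M)
      also have "\<dots> = emeasure lborel (C \<inter> {z..<x})"
        using AE_lborel_singleton[of z] by (intro emeasure_eq_AE) (auto elim!: eventually_mono)
      also have "\<dots> = ennreal (measure lborel (C \<inter> {z..<x}))"
        using fmeasurable_S_piece[OF C, of z x] by (simp add: emeasure_eq_measure2 fmeasurableD2)
      also have "measure lborel (C \<inter> {z..<x}) = S C x - s" using S_add[OF C z'(1,2)] z' by simp
      also have "ennreal (S C x - s) = emeasure lborel {s<..<S C x}" using 3 by simp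
      also have "\<dots> = emeasure N {s<..}"
      proof -
        have "{0..<S C x} \<inter> {s<..} = {s<..<S C x}" using 3 by auto
        then show ?thesis by (simp add: N)
      qed
      finally show ?thesis .
    qed
  qed
  then have "emeasure M A = emeasure N A" by simp
  moreover have "K \<inter> S C -` A = thin C A \<inter> {0..<x}" by (auto simp: K_def thin_def)
  moreover have "{0..<S C x} \<inter> A = A \<inter> {0..<S C x}" by auto
  ultimately have "emeasure lborel (thin C A \<inter> {0..<x}) = emeasure lborel (A \<inter> {0..<S C x})"
    by (simp add: M N A)
  then show ?thesis by (simp add: S_def[of "thin C A"] S_def[of A "S C x"] measure_def)
qed

text \<open>
Membership in \<open>thin C A\<close> can only change at a jump of \<open>C\<close> or at a point of \<open>C\<close> that \<open>S C\<close> sends to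
a jump of \<open>A\<close>. As \<open>S C\<close> is injective on \<open>C\<close> and \<open>S C x \<le> x\<close>, the latter points are locally finite.
\<close>
lemma MM_thin: assumes C: "C \<in> MM" and A: "A \<in> MM" shows "thin C A \<in> MM"
proof -
  obtain D E where D: "jump_set D C" and E: "jump_set E A" using assms MM_iff by blast
  have Cb: "C \<in> sets borel" and C0: "C \<subseteq> {0..}" using C MM_borel MM_nonneg by auto
  define P where "P = {x \<in> C. S C x \<in> E}"
  have "jump_set (D \<union> P) (thin C A)"
    unfolding jump_set_def
  proof (intro conjI allI impI)
    fix R
    have "S C ` (P \<inter> {..R}) \<subseteq> E \<inter> {..R}"
    proof (rule image_subsetI)
      fix x assume x: "x \<in> P \<inter> {..R}"
      then have "S C x \<le> x" using S_le[OF Cb, of x] C0 by (auto simp: P_def)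
      then show "S C x \<in> E \<inter> {..R}" using x by (auto simp: P_def)
    qed
    then have "finite (S C ` (P \<inter> {..R}))" using jump_set_finite[OF E] finite_subset by blast
    moreover have "inj_on (S C) (P \<inter> {..R})"
      using strict_mono_on_imp_inj_on[OF S_strict_mono_on[OF C]]
      by (rule inj_on_subset) (auto simp: P_def)
    ultimately have "finite (P \<inter> {..R})" by (rule finite_imageD)
    then show "finite ((D \<union> P) \<inter> {..R})"
      using jump_set_finite[OF D, of R] by (simp add: Int_Un_distrib2)
  next
    fix x y :: real assume *: "0 \<le> x \<and> x \<le> y \<and> (D \<union> P) \<inter> {x<..y} = {}"
    have zC: "z \<in> C \<longleftrightarrow> x \<in> C" if "x \<le> z" "z \<le> y" for z
      by (rule jump_set_constant[OF D, symmetric]) (use * that in auto)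
    show "x \<in> thin C A \<longleftrightarrow> y \<in> thin C A"
    proof (cases "x \<in> C")
      case False
      then show ?thesis using zC[of y] * by (auto simp: thin_def)
    next
      case True
      have SC: "S C z = S C x + (z - x)" if "x \<le> z" "z \<le> y" for z
        by (rule S_eq_increment_interval[OF Cb]) (use that * zC True in auto)
      have "E \<inter> {S C x<..S C y} = {}"
      proof (rule ccontr)
        assume "E \<inter> {S C x<..S C y} \<noteq> {}"
        then obtain d where d: "d \<in> E" "S C x < d" "d \<le> S C y" by auto
        define z where "z = x + (d - S C x)"
        have z: "x < z" "z \<le> y" using d SC[of y] * by (auto simp: z_def)
        then have "S C z = d" using SC[of z] by (simp add: z_def)
        then have "z \<in> P" using zC[of z] z True d by (auto simp: P_def)
        then show False using * z by auto
      qed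
      then have "S C x \<in> A \<longleftrightarrow> S C y \<in> A"
        by (intro jump_set_constant[OF E]) (use * SC[of y] S_nonneg[of C x] in auto)
      then show ?thesis using zC[of y] * True by (auto simp: thin_def)
    qed
  qed
  then show ?thesis by (rule MM_I[rotated]) (auto simp: thin_def)
qed

section \<open>Logarithmic averages by parts\<close>


lemma S_has_derivative:
  assumes A: "A \<in> MM" and D: "jump_set D A" and x: "0 < x" "x \<notin> D"
  shows "(S A has_real_derivative indicator A x) (at x)"
proof -
  obtain e where e: "0 < e" "\<And>d. d \<in> D \<inter> {..x + 1} \<Longrightarrow> d \<noteq> x \<Longrightarrow> e \<le> dist x d"
    using finite_set_avoid[OF jump_set_finite[OF D, of "x + 1"], of x] by auto
  define r where "r = min (min e 1) x"
  have r: "0 < r" "r \<le> x" "r \<le> 1" "r \<le> e" using e x by (auto simp: r_def)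
  have Ab: "A \<in> sets borel" using A MM_borel by auto
  have noD: "d \<notin> D" if "\<bar>d - x\<bar> < r" for d
  proof
    assume d: "d \<in> D"
    then have "d \<noteq> x" "d \<le> x + 1" using x(2) that r by auto
    then show False using e(2)[of d] d that r by (auto simp: dist_real_def)
  qed
  have const: "y \<in> A \<longleftrightarrow> x \<in> A" if "\<bar>y - x\<bar> < r" for y
  proof (cases "x \<le> y")
    case True
    have "D \<inter> {x<..y} = {}" using noD that by force
    then show ?thesis using jump_set_constant[OF D _ True] x by auto
  next
    case False
    have "D \<inter> {y<..x} = {}" using noD that by force
    then show ?thesis using jump_set_constant[OF D _ , of y x] False that r by auto
  qed
  have inc: "S A v = S A u + indicator A x * (v - u)" if uv: "x - r < u" "u \<le> v" "v < x + r" for u v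
  proof -
    have uv': "w \<in> A \<longleftrightarrow> x \<in> A" if "w \<in> {u..<v}" for w
      by (rule const) (use that uv in \<open>auto simp: abs_less_iff\<close>)
    show ?thesis
    proof (cases "x \<in> A")
      case True
      then have "{u..<v} \<subseteq> A" using uv' by blast
      then show ?thesis using S_eq_increment_interval[OF Ab, of u v] uv r True by simp
    next
      case False
      then have "A \<inter> {u..<v} = {}" using uv' by blast
      then show ?thesis using S_add[OF Ab, of u v] uv r False by simp
    qed
  qed
  have "((\<lambda>y. S A x + indicator A x * (y - x)) has_real_derivative indicator A x) (at x)"
    by (auto intro!: derivative_eq_intros)
  then show ?thesis
  proof (rule has_field_derivative_transform_within_open)
    show "open {x - r<..<x + r}" "x \<in> {x - r<..<x + r}" using r by auto
    fix y assume y: "y \<in> {x - r<..<x + r}"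
    show "S A x + indicator A x * (y - x) = S A y"
      using inc[of x y] inc[of y x] y r by (cases "x \<le> y") (auto simp: algebra_simps)
  qed
qed

text \<open>
As \<open>S A u / u\<^sup>2 = rho A u / u\<close>, this is the unnormalised logarithmic average of the density
\<open>rho A\<close>.
\<close>
definition rho_integral :: "real set \<Rightarrow> real \<Rightarrow> real \<Rightarrow> real" where
  "rho_integral A x y = integral {x..y} (\<lambda>u. S A u / u\<^sup>2)"

lemma rho_integral_integrable:
  assumes "A \<in> sets borel" "0 < x" shows "(\<lambda>u. S A u / u\<^sup>2) integrable_on {x..y}"
proof (rule integrable_continuous_real)
  have "continuous_on {x..y} (S A)"
    by (rule continuous_on_subset[OF continuous_on_S]) (use assms in auto)
  then show "continuous_on {x..y} (\<lambda>u. S A u / u\<^sup>2)"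
    using assms by (intro continuous_intros) auto
qed

text \<open>
Integration by parts: off the jumps of \<open>A\<close>, the derivative of \<open>S A u / u\<close> is
\<open>indicator A u / u - S A u / u\<^sup>2\<close>, and on a bounded interval there are only finitely many
jumps.
\<close>
lemma indicator_over_id_has_integral:
  assumes A: "A \<in> MM" and x: "0 < x" "x \<le> y"
  shows "((\<lambda>u. indicator A u / u) has_integral (S A y / y - S A x / x + rho_integral A x y)) {x..y}"
proof -
  have Ab: "A \<in> sets borel" using A MM_borel by auto
  obtain D where D: "jump_set D A" using A MM_iff by blast
  have "((\<lambda>u. indicator A u / u - S A u / u\<^sup>2) has_integral (S A y / y - S A x / x)) {x..y}"
  proof (rule fundamental_theorem_of_calculus_interior_strong[OF jump_set_finite[OF D, of y] x(2)])
    have "continuous_on {x..y} (S A)"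
      by (rule continuous_on_subset[OF continuous_on_S[OF Ab]]) (use x in auto)
    then show "continuous_on {x..y} (\<lambda>u. S A u / u)"
      using x by (intro continuous_intros) auto
    fix u assume u: "u \<in> {x<..<y} - D \<inter> {..y}"
    then have "(S A has_real_derivative indicator A u) (at u)"
      using S_has_derivative[OF A D, of u] x by auto
    then have "((\<lambda>u. S A u / u) has_real_derivative indicator A u / u - S A u / u\<^sup>2) (at u)"
      using u x by (auto intro!: derivative_eq_intros simp: power2_eq_square divide_simps)
    then show "((\<lambda>u. S A u / u) has_vector_derivative indicator A u / u - S A u / u\<^sup>2) (at u)"
      by (simp add: has_real_derivative_iff_has_vector_derivative)
  qed
  from has_integral_add[OF this integrable_integral[OF rho_integral_integrable[OF Ab x(1), of y]]]
  show ?thesis by (simp add: rho_integral_def)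
qed

lemma log_avg_eq:
  assumes A: "A \<in> MM" and x: "0 < x" "1 < D"
  shows "ln D * log_avg A x D = S A (x * D) / (x * D) - S A x / x + rho_integral A x (x * D)"
proof -
  note MM_borel[OF A, measurable]
  have xy: "x \<le> x * D" using x by simp
  have "set_integrable lborel {x..x * D} (\<lambda>u. indicator A u / u)"
    unfolding set_integrable_def
  proof (rule integrableI_bounded_set[where A = "{x..x * D}" and B = "1 / x"])
    show "AE u\<in>{x..x * D} in lborel. norm (indicator {x..x * D} u *\<^sub>R (indicator A u / u)) \<le> 1 / x"
      using x by (intro AE_I2) (auto simp: indicator_def divide_simps)
  qed (use x in auto)
  then have "(LINT u:{x..x * D}|lborel. indicator A u / u)
      = integral {x..x * D} (\<lambda>u. indicator A u / u)"
    by (rule set_borel_integral_eq_integral(2))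
  also have "\<dots> = S A (x * D) / (x * D) - S A x / x + rho_integral A x (x * D)"
    by (rule integral_unique[OF indicator_over_id_has_integral[OF A x(1) xy]])
  finally show ?thesis using x by (simp add: log_avg_def)
qed

lemma has_integral_affine_over_square:
  fixes a b x y :: real
  assumes "0 < x" "x \<le> y"
  shows "((\<lambda>u. (a * u + b) / u\<^sup>2) has_integral (a * ln (y / x) + b * (1 / x - 1 / y))) {x..y}"
proof -
  have "((\<lambda>u. (a * u + b) / u\<^sup>2) has_integral (a * ln y - b / y) - (a * ln x - b / x)) {x..y}"
  proof (rule fundamental_theorem_of_calculus[OF assms(2)])
    fix u assume u: "u \<in> {x..y}"
    have "((\<lambda>u. a * ln u - b / u) has_real_derivative (a * u + b) / u\<^sup>2) (at u within {x..y})"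
      using u assms by (auto intro!: derivative_eq_intros simp: power2_eq_square field_simps)
    then show "((\<lambda>u. a * ln u - b / u) has_vector_derivative (a * u + b) / u\<^sup>2) (at u within {x..y})"
      by (simp add: has_real_derivative_iff_has_vector_derivative)
  qed
  moreover have "(a * ln y - b / y) - (a * ln x - b / x) = a * ln (y / x) + b * (1 / x - 1 / y)"
    using assms by (simp add: ln_div algebra_simps)
  ultimately show ?thesis by simp
qed

text \<open>
Comparison with an affine function: a linear bound contributes a logarithm, which survives
division by \<open>ln D\<close>, and a constant contributes a bounded term, which does not.
\<close>
lemma integral_over_square_le:
  fixes a b x y :: real
  assumes "0 < x" "x \<le> y" "(\<lambda>u. f u / u\<^sup>2) integrable_on {x..y}" "\<And>u. u \<in> {x..y} \<Longrightarrow> f u \<le> a * u + b"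
  shows "integral {x..y} (\<lambda>u. f u / u\<^sup>2) \<le> a * ln (y / x) + b * (1 / x - 1 / y)"
  by (rule has_integral_le[OF integrable_integral[OF assms(3)] has_integral_affine_over_square[OF assms(1,2)]])
     (use assms in \<open>auto intro!: divide_right_mono\<close>)

lemma rho_integral_nonneg: "0 \<le> rho_integral A x y"
  unfolding rho_integral_def
  by (cases "(\<lambda>u. S A u / u\<^sup>2) integrable_on {x..y}")
     (auto simp: S_nonneg not_integrable_integral intro!: Henstock_Kurzweil_Integration.integral_nonneg)

lemma rho_integral_le:
  assumes "A \<in> sets borel" "0 < x" "x \<le> y" shows "rho_integral A x y \<le> ln (y / x)"
  unfolding rho_integral_def
  using integral_over_square_le[OF assms(2,3) rho_integral_integrable[OF assms(1,2)], of 1 0] S_le assms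
    by auto

lemma rho_integral_combine:
  assumes "A \<in> sets borel" "0 < x" "x \<le> y" "y \<le> z"
  shows "rho_integral A x y + rho_integral A y z = rho_integral A x z"
  unfolding rho_integral_def
    by (rule Henstock_Kurzweil_Integration.integral_combine) (use assms rho_integral_integrable in auto)

text \<open>
Scaling both limits by \<open>c\<close> changes the interval only at its two ends, by pieces of
logarithmic length \<open>ln c\<close>.
\<close>
lemma rho_integral_shift:
  assumes "A \<in> sets borel" "0 < x" "x \<le> y" "1 \<le> c"
  shows "\<bar>rho_integral A (c * x) (c * y) - rho_integral A x y\<bar> \<le> ln c"
proof -
  have le: "x \<le> c * x" "y \<le> c * y" "c * x \<le> c * y" "0 < y" using assms by auto
  have "rho_integral A x (c * x) + rho_integral A (c * x) (c * y) = rho_integral A x (c * y)"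
       "rho_integral A x y + rho_integral A y (c * y) = rho_integral A x (c * y)"
    using rho_integral_combine assms le by auto
  moreover have "rho_integral A x (c * x) \<le> ln c" "rho_integral A y (c * y) \<le> ln c"
    using rho_integral_le[OF assms(1,2) le(1)] rho_integral_le[OF assms(1) le(4) le(2)] assms le by auto
  ultimately show ?thesis using rho_integral_nonneg[of A x "c * x"] rho_integral_nonneg[of A y "c * y"]
    by linarith
qed

lemma rho_integral_shift':
  assumes "A \<in> sets borel" "0 < x" "x \<le> y" "0 < c"
  shows "\<bar>rho_integral A (c * x) (c * y) - rho_integral A x y\<bar> \<le> \<bar>ln c\<bar>"
proof (cases "1 \<le> c")
  case True then show ?thesis using rho_integral_shift[OF assms(1-3)] by simp
next
  case False
  have "\<bar>rho_integral A (inverse c * (c * x)) (inverse c * (c * y)) - rho_integral A (c * x) (c * y)\<bar> \<le> ln (inverse c)"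
    by (rule rho_integral_shift) (use assms False in \<open>auto simp: one_le_inverse_iff\<close>)
  moreover have "inverse c * (c * u) = u" for u using assms by simp
  ultimately show ?thesis using assms False by (simp add: ln_inverse)
qed

lemma integral_S_scaled:
  assumes "A \<in> sets borel" "0 < x" "x \<le> y" "0 < c"
  shows "((\<lambda>u. S A (c * u) / u\<^sup>2) has_integral c * rho_integral A (c * x) (c * y)) {x..y}"
proof -
  have "((\<lambda>u. S A u / u\<^sup>2) has_integral rho_integral A (c * x) (c * y)) {c * x..c * y}"
    unfolding rho_integral_def
      by (rule integrable_integral[OF rho_integral_integrable]) (use assms in auto)
  from has_integral_stretch_real[OF this, of c]
  have "((\<lambda>u. S A (c * u) / (c * u)\<^sup>2)
      has_integral (1 / c) * rho_integral A (c * x) (c * y)) ((\<lambda>u. u / c) ` {c * x..c * y})"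
    using assms by simp
  moreover have "(\<lambda>u. u / c) ` {c * x..c * y} = {x..y}" using assms by simp
  ultimately have "((\<lambda>u. S A (c * u) / (c * u)\<^sup>2)
      has_integral (1 / c) * rho_integral A (c * x) (c * y)) {x..y}"
    by simp
  from has_integral_mult_right[OF this, of "c\<^sup>2"]
  show ?thesis using assms by (simp add: power_mult_distrib power2_eq_square)
qed

text \<open>
By \<open>S_thin\<close>, the counting function of \<open>thin C A\<close> is \<open>S A (S C u)\<close>, which differs from
\<open>S A (c * u)\<close> by at most \<open>e * u + R\<close> because \<open>S A\<close> is 1-Lipschitz. Integrated against \<open>1 / u\<^sup>2\<close>,
this error costs \<open>e * ln D + R\<close>; the boundary terms of the integration by parts cost 2 and
the shift of the limits by the factor \<open>c\<close> costs \<open>\<bar>ln c\<bar>\<close>. For \<open>c = 0\<close> the convention \<open>ln 0 = 0\<close>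
makes the bound read correctly.
\<close>
lemma log_avg_thin:
  assumes C: "C \<in> MM" and A: "A \<in> MM" and c: "0 \<le> c" "c \<le> 1" and R: "0 \<le> R"
    and dens: "\<And>u. 0 \<le> u \<Longrightarrow> \<bar>S C u - c * u\<bar> \<le> e * u + R"
    and x: "1 \<le> x" "1 < D"
  shows "\<bar>log_avg (thin C A) x D - c * log_avg A x D\<bar> \<le> e + (R + 2 + \<bar>ln c\<bar>) / ln D"
proof -
  note Cb = MM_borel[OF C] and Ab = MM_borel[OF A]
  have TA: "thin C A \<in> MM" by (rule MM_thin[OF C A])
  note TAb = MM_borel[OF TA]
  have xy: "0 < x" "x \<le> x * D" "0 < x * D" using x by auto
  have lnD: "0 < ln D" using x by simp
  have bd: "0 \<le> S B u / u" "S B u / u \<le> 1" if "B \<in> sets borel" "0 < u" for B u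
    using S_nonneg S_le[OF that(1), of u] that by auto
  have "1 / x - 1 / (x * D) \<le> 1 / x" using xy by simp
  also have "\<dots> \<le> 1" using x by simp
  finally have Rb: "R * (1 / x - 1 / (x * D)) \<le> R" using R mult_left_mono[of _ 1 R] by simp
  have T1: "\<bar>rho_integral (thin C A) x (x * D) - c * rho_integral A (c * x) (c * (x * D))\<bar>
      \<le> e * ln D + R"
  proof -
    let ?f = "\<lambda>u. S (thin C A) u - S A (c * u)"
    have i1: "((\<lambda>u. S (thin C A) u / u\<^sup>2) has_integral rho_integral (thin C A) x (x * D)) {x..x * D}"
      unfolding rho_integral_def by (rule integrable_integral[OF rho_integral_integrable[OF TAb xy(1)]])
    have i2: "((\<lambda>u. S A (c * u) / u\<^sup>2)
        has_integral c * rho_integral A (c * x) (c * (x * D))) {x..x * D}"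
      using integral_S_scaled[OF Ab xy(1,2)] c by (cases "c = 0") auto
    have i: "((\<lambda>u. ?f u / u\<^sup>2)
        has_integral (rho_integral (thin C A) x (x * D) - c * rho_integral A (c * x) (c * (x * D)))) {x..x * D}"
      using has_integral_diff[OF i1 i2] by (simp add: diff_divide_distrib)
    have i': "((\<lambda>u. (- ?f u) / u\<^sup>2)
        has_integral - (rho_integral (thin C A) x (x * D) - c * rho_integral A (c * x) (c * (x * D)))) {x..x * D}"
      using has_integral_neg[OF i] by (simp add: minus_divide_left)
    have f: "\<bar>?f u\<bar> \<le> e * u + R" if "u \<in> {x..x * D}" for u
    proof -
      have u: "0 \<le> u" using that x by auto
      have "?f u = S A (S C u) - S A (c * u)" using S_thin[OF Cb Ab u] by simp
      then have "\<bar>?f u\<bar> \<le> \<bar>S C u - c * u\<bar>" using S_lipschitz[OF Ab] S_nonneg c u by simp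
      then show ?thesis using dens[OF u] by simp
    qed
    have "rho_integral (thin C A) x (x * D) - c * rho_integral A (c * x) (c * (x * D))
        \<le> e * ln (x * D / x) + R * (1 / x - 1 / (x * D))"
      using integral_over_square_le[OF xy(1,2), of ?f e R] i f integral_unique[OF i] by fastforce
    moreover have "- (rho_integral (thin C A) x (x * D) - c * rho_integral A (c * x) (c * (x * D)))
        \<le> e * ln (x * D / x) + R * (1 / x - 1 / (x * D))"
      using integral_over_square_le[OF xy(1,2), of "\<lambda>u. - ?f u" e R] i' f integral_unique[OF i']
        by fastforce
    ultimately show ?thesis using Rb xy by (simp add: abs_le_iff)
  qed
  have T2: "\<bar>c * rho_integral A (c * x) (c * (x * D)) - c * rho_integral A x (x * D)\<bar> \<le> \<bar>ln c\<bar>"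
  proof (cases "c = 0")
    case False
    then have "\<bar>rho_integral A (c * x) (c * (x * D)) - rho_integral A x (x * D)\<bar> \<le> \<bar>ln c\<bar>"
      using rho_integral_shift'[OF Ab xy(1,2), of c] c by linarith
    then have "c * \<bar>rho_integral A (c * x) (c * (x * D)) - rho_integral A x (x * D)\<bar> \<le> 1 * \<bar>ln c\<bar>"
      using c by (intro mult_mono) auto
    then show ?thesis using c by (simp add: abs_mult flip: right_diff_distrib)
  qed simp
  define p where "p = S A (x * D) / (x * D) - S A x / x"
  have "\<bar>p\<bar> \<le> 1" unfolding p_def using bd[OF Ab xy(1)] bd[OF Ab xy(3)] by linarith
  then have p: "\<bar>c * p\<bar> \<le> 1" using c by (simp add: abs_mult mult_le_one)
  have "ln D * (log_avg (thin C A) x D - c * log_avg A x D)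
      = ln D * log_avg (thin C A) x D - c * (ln D * log_avg A x D)"
    by (simp add: algebra_simps)
  also have "\<dots> = (S (thin C A) (x * D) / (x * D) - S (thin C A) x / x) - c * p
        + (rho_integral (thin C A) x (x * D) - c * rho_integral A x (x * D))"
    unfolding log_avg_eq[OF TA xy(1) x(2)] log_avg_eq[OF A xy(1) x(2)] p_def
    by (simp only: algebra_simps)
  finally have eq: "ln D * (log_avg (thin C A) x D - c * log_avg A x D)
      = (S (thin C A) (x * D) / (x * D) - S (thin C A) x / x) - c * p
        + (rho_integral (thin C A) x (x * D) - c * rho_integral A x (x * D))" .
  have "\<bar>ln D * (log_avg (thin C A) x D - c * log_avg A x D)\<bar> \<le> 2 + \<bar>ln c\<bar> + (e * ln D + R)"
    unfolding eq using bd[OF TAb xy(1)] bd[OF TAb xy(3)] p T1 T2 by linarith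
  then have "ln D * \<bar>log_avg (thin C A) x D - c * log_avg A x D\<bar> \<le> 2 + \<bar>ln c\<bar> + (e * ln D + R)"
    by (simp only: abs_mult abs_of_pos[OF lnD])
  moreover have "y \<le> e + (R + 2 + \<bar>ln c\<bar>) / ln D" if "ln D * y \<le> 2 + \<bar>ln c\<bar> + (e * ln D + R)" for y
    using that lnD by (simp add: field_simps)
  ultimately show ?thesis by blast
qed

lemma log_avg_has_integral:
  assumes "A \<in> MM" "0 < x" "1 < D"
  shows "((\<lambda>u. indicator A u / u) has_integral (ln D * log_avg A x D)) {x..x * D}"
  using indicator_over_id_has_integral[of A x "x * D"] log_avg_eq[OF assms] assms by simp

lemma inverse_has_integral:
  assumes "0 < x" "1 < (D::real)"
  shows "((\<lambda>u. k / u) has_integral (k * ln D)) {x..x * D}"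
proof -
  have "((\<lambda>u. (k * u + 0) / u\<^sup>2)
      has_integral (k * ln (x * D / x) + 0 * (1 / x - 1 / (x * D)))) {x..x * D}"
    by (rule has_integral_affine_over_square) (use assms in auto)
  moreover have "(k * u + 0) / u\<^sup>2 = k / u" for u by (simp add: power2_eq_square)
  ultimately show ?thesis using assms by simp
qed

text \<open>
Logarithmic averaging is a positive linear functional. This is what makes limits of
averages coherent, and it also confines the averages to \<open>{0..1}\<close>.
\<close>
lemma sum_log_avg_le:
  assumes A: "\<And>i. i \<in> I \<Longrightarrow> A i \<in> MM" and I: "finite I" and x: "0 < x" "1 < D"
    and le: "\<And>u. 0 \<le> u \<Longrightarrow> (\<Sum>i\<in>I. c i * indicator (A i) u) \<le> k"
  shows "(\<Sum>i\<in>I. c i * log_avg (A i) x D) \<le> k"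
proof -
  have "((\<lambda>u. \<Sum>i\<in>I. c i * (indicator (A i) u / u))
      has_integral (\<Sum>i\<in>I. c i * (ln D * log_avg (A i) x D))) {x..x * D}"
    using A x by (intro has_integral_sum[OF I] has_integral_mult_right log_avg_has_integral)
  moreover have "((\<lambda>u. k / u) has_integral (k * ln D)) {x..x * D}" by (rule inverse_has_integral[OF x])
  moreover have "(\<Sum>i\<in>I. c i * (indicator (A i) u / u)) \<le> k / u" if "u \<in> {x..x * D}" for u
  proof -
    have "(\<Sum>i\<in>I. c i * indicator (A i) u) / u \<le> k / u"
      by (rule divide_right_mono[OF le]) (use that x in auto)
    then show ?thesis by (simp add: sum_divide_distrib)
  qed
  ultimately have "(\<Sum>i\<in>I. c i * (ln D * log_avg (A i) x D)) \<le> k * ln D" by (rule has_integral_le)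
  moreover have "(\<Sum>i\<in>I. c i * (ln D * log_avg (A i) x D)) = (\<Sum>i\<in>I. c i * log_avg (A i) x D) * ln D"
    by (simp add: sum_distrib_right mult_ac flip: sum_distrib_left)
  ultimately show ?thesis using x by simp
qed

lemma log_avg_le_1: "A \<in> MM \<Longrightarrow> 0 < x \<Longrightarrow> 1 < D \<Longrightarrow> log_avg A x D \<le> 1"
  using sum_log_avg_le[of "{()}" "\<lambda>_. A" x D "\<lambda>_. 1" 1] by simp

lemma log_avg_nonneg: "A \<in> MM \<Longrightarrow> 0 < x \<Longrightarrow> 1 < D \<Longrightarrow> 0 \<le> log_avg A x D"
  using sum_log_avg_le[of "{()}" "\<lambda>_. A" x D "\<lambda>_. - 1" 0] by simp

lemma log_avg_Un:
  assumes "A \<in> MM" "B \<in> MM" "A \<inter> B = {}" "0 < x" "1 < D"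
  shows "log_avg (A \<union> B) x D = log_avg A x D + log_avg B x D"
proof -
  have "((\<lambda>u. indicator A u / u + indicator B u / u)
      has_integral (ln D * log_avg A x D + ln D * log_avg B x D)) {x..x * D}"
    using assms by (intro has_integral_add log_avg_has_integral)
  moreover have "indicator A u / u + indicator B u / u = indicator (A \<union> B) u / u" for u
    using assms(3) by (auto simp: indicator_def)
  ultimately have "((\<lambda>u. indicator (A \<union> B) u / u)
      has_integral (ln D * log_avg A x D + ln D * log_avg B x D)) {x..x * D}"
    by simp
  from has_integral_unique[OF this log_avg_has_integral[OF MM_Un[OF assms(1,2)] assms(4,5)]]
  show ?thesis using assms by (simp flip: distrib_left)
qed

lemma log_avg_atLeast_0: "0 < x \<Longrightarrow> 1 < D \<Longrightarrow> log_avg {0..} x D = 1"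
  using log_avg_eq[OF MM_atLeast[of 0], of x D] log_avg_le_1[OF MM_atLeast[of 0], of x D]
    sum_log_avg_le[of "{()}" "\<lambda>_. {0..}" x D "\<lambda>_. - 1" "- 1"] MM_atLeast[of 0] by simp

lemma log_avg_Compl:
  assumes "A \<in> MM" "0 < x" "1 < D"
  shows "log_avg ({0..} - A) x D = 1 - log_avg A x D"
proof -
  have "A \<union> ({0..} - A) = {0..}" using MM_nonneg[OF assms(1)] by auto
  then show ?thesis
    using log_avg_Un[OF assms(1) MM_Compl[OF assms(1)]] log_avg_atLeast_0 assms by fastforce
qed

lemma log_avg_mono_S:
  assumes A: "A \<in> MM" and B: "B \<in> MM" and le: "\<And>u. 0 \<le> u \<Longrightarrow> S B u \<le> S A u" and x: "0 < x" "1 < D"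
  shows "log_avg B x D \<le> log_avg A x D + 2 / ln D"
proof -
  have "rho_integral B x (x * D) \<le> rho_integral A x (x * D)"
    unfolding rho_integral_def
    by (rule integral_le) (use x le MM_borel[OF A] MM_borel[OF B] rho_integral_integrable in \<open>auto intro!: divide_right_mono\<close>)
  moreover have bd: "0 \<le> S E u / u" "S E u / u \<le> 1" if "E \<in> MM" "0 < u" for E u
    using S_nonneg S_le[OF MM_borel[OF that(1)], of u] that by auto
  have "0 < x * D" using x by simp
  ultimately have "ln D * log_avg B x D \<le> ln D * log_avg A x D + 2"
    unfolding log_avg_eq[OF A x] log_avg_eq[OF B x]
    using bd[OF A, of x] bd[OF A, of "x * D"] bd[OF B, of x] bd[OF B, of "x * D"] x(1) by linarith
  then show ?thesis using x by (simp add: field_simps)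
qed

text \<open>
The supremum in the definition of \<open>Auni\<close> is over starting points \<open>x > 1\<close>, whereas \<open>alpha\<close>
averages from \<open>x = 1\<close>; this estimate bridges the gap.
\<close>
lemma log_avg_1_2:
  assumes A: "A \<in> MM" and D: "1 < D"
  shows "\<bar>log_avg A 1 D - log_avg A 2 D\<bar> \<le> (2 + ln 2) / ln D"
proof -
  have bd: "0 \<le> S A u / u" "S A u / u \<le> 1" if "0 < u" for u
    using S_nonneg S_le[OF MM_borel[OF A], of u] that by auto
  have "\<bar>rho_integral A (2 * 1) (2 * D) - rho_integral A 1 D\<bar> \<le> ln 2"
    by (rule rho_integral_shift) (use D MM_borel[OF A] in auto)
  then have "\<bar>ln D * log_avg A 1 D - ln D * log_avg A 2 D\<bar> \<le> 2 + ln 2"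
    unfolding log_avg_eq[OF A zero_less_one D] log_avg_eq[OF A zero_less_numeral D]
    using bd[of 1] bd[of D] bd[of 2] bd[of "2 * D"] D unfolding mult_1 mult_1_right abs_le_iff
    by linarith
  then have "ln D * \<bar>log_avg A 1 D - log_avg A 2 D\<bar> \<le> 2 + ln 2"
    using D by (simp add: abs_mult flip: right_diff_distrib)
  then show ?thesis using D by (simp add: pos_le_divide_eq mult.commute)
qed

section \<open>Limits along filters of windows\<close>

text \<open>
A pair \<open>(x, D)\<close> stands for the window \<open>[x, x D]\<close>. Convergence along this filter is convergence
as \<open>D \<longrightarrow> \<infinity>\<close>, uniformly in \<open>x > 1\<close>; smaller filters select special families of windows.
\<close>
definition windows :: "(real \<times> real) filter" where
  "windows = principal {1<..} \<times>\<^sub>F at_top"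

definition lavg :: "real set \<Rightarrow> real \<times> real \<Rightarrow> real" where
  "lavg A = (\<lambda>(x, D). log_avg A x D)"

lemma eventually_windows:
  "eventually P windows \<longleftrightarrow> (\<forall>\<^sub>F D in at_top. \<forall>x>1. P (x, D))"
proof
  assume "eventually P windows"
  then obtain Q R where "\<And>x. 1 < x \<Longrightarrow> Q x" "eventually R at_top" "\<And>x D. Q x \<Longrightarrow> R D \<Longrightarrow> P (x, D)"
    unfolding windows_def eventually_prod_filter eventually_principal by (metis greaterThan_iff)
  then show "\<forall>\<^sub>F D in at_top. \<forall>x>1. P (x, D)" by (auto elim: eventually_mono)
next
  assume "\<forall>\<^sub>F D in at_top. \<forall>x>1. P (x, D)"
  then show "eventually P windows"
    unfolding windows_def eventually_prod_filter eventually_principal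
    by (intro exI[of _ "\<lambda>x. 1 < x"] exI[of _ "\<lambda>D. \<forall>x>1. P (x, D)"]) auto
qed

lemma eventually_windows_proper: "eventually (\<lambda>(x, D). 1 < x \<and> 1 < D) windows"
  unfolding eventually_windows using eventually_gt_at_top[of 1] by (auto elim: eventually_mono)

lemma inverse_ln_windows: "((\<lambda>p. k / ln (snd p)) \<longlongrightarrow> 0) windows"
proof -
  have "filterlim snd at_top windows"
    unfolding filterlim_at_top eventually_windows by (auto simp: eventually_ge_at_top)
  then have "filterlim (\<lambda>p::real\<times>real. ln (snd p)) at_top windows"
    by (rule filterlim_compose[OF ln_at_top])
  then show ?thesis
    by (intro tendsto_divide_0[OF tendsto_const] filterlim_at_top_imp_at_infinity)
qed

lemma windows_neq_bot: "windows \<noteq> bot"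
  by (simp add: windows_def prod_filter_eq_bot principal_eq_bot_iff)

lemma fixed_start_windows: "1 < x \<Longrightarrow> filterlim (\<lambda>D. (x, D)) windows at_top"
  unfolding filterlim_iff eventually_windows by (auto elim: eventually_mono)

lemma uniform_limit_iff_windows:
  assumes A: "A \<in> MM"
  shows "((\<lambda>D. SUP x\<in>{1<..}. \<bar>log_avg A x D - L\<bar>) \<longlongrightarrow> 0) at_top \<longleftrightarrow> (lavg A \<longlongrightarrow> L) windows"
proof -
  have bdd: "bdd_above ((\<lambda>x. \<bar>log_avg A x D - L\<bar>) ` {1<..})" if "1 < D" for D
  proof (rule bdd_aboveI2)
    fix x :: real assume "x \<in> {1<..}"
    then show "\<bar>log_avg A x D - L\<bar> \<le> 1 + \<bar>L\<bar>"
      using log_avg_nonneg[OF A, of x D] log_avg_le_1[OF A, of x D] that by auto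
  qed
  have upper: "\<bar>log_avg A x D - L\<bar> \<le> (SUP x\<in>{1<..}. \<bar>log_avg A x D - L\<bar>)" if "1 < D" "1 < x" for x D
    by (rule cSUP_upper[OF _ bdd]) (use that in auto)
  show ?thesis
  proof
    assume l: "((\<lambda>D. SUP x\<in>{1<..}. \<bar>log_avg A x D - L\<bar>) \<longlongrightarrow> 0) at_top"
    show "(lavg A \<longlongrightarrow> L) windows"
    proof (rule tendstoI)
      fix e :: real assume "0 < e"
      from tendstoD[OF l this] eventually_gt_at_top[of 1]
      show "\<forall>\<^sub>F p in windows. dist (lavg A p) L < e"
        unfolding eventually_windows
      proof eventually_elim
        case (elim D)
        then show ?case using upper[of D] by (fastforce simp: lavg_def dist_real_def)
      qed
    qed
  next
    assume l: "(lavg A \<longlongrightarrow> L) windows"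
    show "((\<lambda>D. SUP x\<in>{1<..}. \<bar>log_avg A x D - L\<bar>) \<longlongrightarrow> 0) at_top"
    proof (rule tendstoI)
      fix e :: real assume e: "0 < e"
      from tendstoD[OF l, of "e / 2"] e have "\<forall>\<^sub>F D in at_top. \<forall>x>1. \<bar>log_avg A x D - L\<bar> < e / 2"
        unfolding eventually_windows by (simp add: lavg_def dist_real_def)
      from this eventually_gt_at_top[of 1]
      show "\<forall>\<^sub>F D in at_top. dist (SUP x\<in>{1<..}. \<bar>log_avg A x D - L\<bar>) 0 < e"
      proof eventually_elim
        case (elim D)
        have "(SUP x\<in>{1<..}. \<bar>log_avg A x D - L\<bar>) \<le> e / 2"
          by (rule cSUP_least) (use elim in \<open>auto simp: less_imp_le\<close>)
        moreover have "0 \<le> (SUP x\<in>{1<..}. \<bar>log_avg A x D - L\<bar>)"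
          using upper[OF elim(2), of 2] abs_ge_zero order_trans by fastforce
        ultimately show ?case using e by (simp add: dist_real_def)
      qed
    qed
  qed
qed

lemma Auni_iff: "A \<in> Auni \<longleftrightarrow> A \<in> MM \<and> (\<exists>L. (lavg A \<longlongrightarrow> L) windows)"
  unfolding Auni_def using uniform_limit_iff_windows by auto

lemma alpha_eqI:
  assumes A: "A \<in> MM" and l: "(lavg A \<longlongrightarrow> L) windows" shows "alpha A = L"
proof -
  have "((\<lambda>D. lavg A (2, D)) \<longlongrightarrow> L) at_top"
    using filterlim_compose[OF l fixed_start_windows[of 2]] by simp
  moreover have "((\<lambda>D. log_avg A 1 D - log_avg A 2 D) \<longlongrightarrow> 0) at_top"
  proof (rule Lim_null_comparison)
    show "\<forall>\<^sub>F D in at_top. norm (log_avg A 1 D - log_avg A 2 D) \<le> (2 + ln 2) / ln D"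
      using eventually_gt_at_top[of 1] by eventually_elim (simp add: log_avg_1_2[OF A])
    show "((\<lambda>D. (2 + ln 2) / ln D) \<longlongrightarrow> (0::real)) at_top"
      by (intro tendsto_divide_0[OF tendsto_const] filterlim_at_top_imp_at_infinity ln_at_top)
  qed
  ultimately have "(log_avg A 1 \<longlongrightarrow> L) at_top"
    using tendsto_add by (fastforce simp: lavg_def)
  then show ?thesis unfolding alpha_def by (intro tendsto_Lim) simp_all
qed

lemma alpha_limit: "A \<in> Auni \<Longrightarrow> (lavg A \<longlongrightarrow> alpha A) windows"
  using alpha_eqI Auni_iff by blast

section \<open>Density\<close>

text \<open>
Convergence of \<open>S C u / u\<close> to \<open>c\<close>, written with an affine error bound that holds on the whole
half-line and can therefore be integrated over any window.
\<close>
definition has_density :: "real set \<Rightarrow> real \<Rightarrow> bool" where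
  "has_density C c \<longleftrightarrow> 0 \<le> c \<and> c \<le> 1 \<and> (\<forall>e>0. \<exists>R\<ge>0. \<forall>u\<ge>0. \<bar>S C u - c * u\<bar> \<le> e * u + R)"

lemma rho_eq:
  assumes "A \<in> sets borel" "0 < x" shows "rho A x = S A x / x"
proof -
  have "(LINT y:{0..x}|lborel. indicator A y) = (LINT y|lborel. indicator (A \<inter> {0..x}) y)"
    unfolding set_lebesgue_integral_def
      by (intro Bochner_Integration.integral_cong) (auto simp: indicator_def)
  also have "\<dots> = measure lborel (A \<inter> {0..x})" by simp
  also have "\<dots> = measure lborel (A \<inter> {0..<x})"
    using AE_lborel_singleton[of x] assms by (intro measure_eq_AE) (auto elim!: eventually_mono)
  finally show ?thesis using assms by (simp add: rho_def S_def)
qed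

lemma CC_iff: "C \<in> CC \<longleftrightarrow> C \<in> MM \<and> (\<exists>c. has_density C c)"
proof
  assume "C \<in> CC"
  then obtain c where C: "C \<in> MM" and c: "(rho C \<longlongrightarrow> c) at_top" by (auto simp: CC_def)
  note Cb = MM_borel[OF C]
  have l: "((\<lambda>u. S C u / u) \<longlongrightarrow> c) at_top"
  proof (rule Lim_transform_eventually[OF c])
    show "\<forall>\<^sub>F u in at_top. rho C u = S C u / u"
      using eventually_gt_at_top[of 0] by eventually_elim (simp add: rho_eq[OF Cb])
  qed
  have c0: "0 \<le> c"
    by (rule tendsto_lowerbound[OF l])
       (use eventually_gt_at_top[of 0] in \<open>eventually_elim, simp add: S_nonneg\<close>, simp)
  have c1: "c \<le> 1"
    by (rule tendsto_upperbound[OF l])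
       (use eventually_gt_at_top[of 0] in \<open>eventually_elim, simp add: S_le[OF Cb]\<close>, simp)
  have "\<exists>R\<ge>0. \<forall>u\<ge>0. \<bar>S C u - c * u\<bar> \<le> e * u + R" if e: "0 < e" for e
  proof -
    obtain R where R: "\<And>u. R \<le> u \<Longrightarrow> \<bar>S C u / u - c\<bar> < e"
      using tendstoD[OF l e] unfolding eventually_at_top_linorder dist_real_def by blast
    have "\<bar>S C u - c * u\<bar> \<le> e * u + max R 1" if u: "0 \<le> u" for u
    proof (cases "max R 1 \<le> u")
      case True
      then have "u * \<bar>S C u / u - c\<bar> \<le> u * e" using R[of u] by (intro mult_left_mono) auto
      moreover have "u * \<bar>S C u / u - c\<bar> = \<bar>S C u - c * u\<bar>"
        using True by (simp add: abs_mult_pos' right_diff_distrib mult.commute[of c])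
      ultimately show ?thesis using True by (simp add: mult.commute)
    next
      case False
      have "0 \<le> c * u" "c * u \<le> u" using c0 c1 u by (auto simp: mult_left_le_one_le)
      then have "\<bar>S C u - c * u\<bar> \<le> u" using S_nonneg[of C u] S_le[OF Cb u] by linarith
      moreover have "0 \<le> e * u" using u \<open>0 < e\<close> by simp
      ultimately show ?thesis using False by linarith
    qed
    then show ?thesis by (intro exI[of _ "max R 1"]) auto
  qed
  then show "C \<in> MM \<and> (\<exists>c. has_density C c)" using C c0 c1 unfolding has_density_def by blast
next
  assume "C \<in> MM \<and> (\<exists>c. has_density C c)"
  then obtain c where C: "C \<in> MM" and c: "has_density C c" by blast
  have "(rho C \<longlongrightarrow> c) at_top"
  proof (rule tendstoI)
    fix e :: real assume e: "0 < e"
    obtain R where R: "0 \<le> R" "\<And>u. 0 \<le> u \<Longrightarrow> \<bar>S C u - c * u\<bar> \<le> (e / 2) * u + R"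
      using c e unfolding has_density_def by (metis half_gt_zero)
    show "\<forall>\<^sub>F u in at_top. dist (rho C u) c < e"
      using eventually_gt_at_top[of "max 0 (2 * R / e)"]
    proof eventually_elim
      case (elim u)
      then have u: "0 < u" "2 * R < e * u" using e by (auto simp: field_simps)
      have "u * \<bar>S C u / u - c\<bar> = \<bar>S C u - c * u\<bar>"
        using u by (simp add: abs_mult_pos' right_diff_distrib mult.commute[of c])
      also have "\<dots> < u * e" using R(2)[of u] u by (simp add: algebra_simps)
      finally show ?case using u by (simp add: rho_eq[OF MM_borel[OF C]] dist_real_def)
    qed
  qed
  then show "C \<in> CC" using C by (auto simp: CC_def)
qed

lemma has_densityI_bounded:
  assumes "0 \<le> c" "c \<le> 1" "0 \<le> K" "\<And>u. 0 \<le> u \<Longrightarrow> \<bar>S C u - c * u\<bar> \<le> K"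
  shows "has_density C c"
  unfolding has_density_def
proof (intro conjI allI impI assms(1,2))
  fix e :: real assume "0 < e"
  then show "\<exists>R\<ge>0. \<forall>u\<ge>0. \<bar>S C u - c * u\<bar> \<le> e * u + R"
    using assms(3,4) by (intro exI[of _ K]) (auto intro: order_trans[OF assms(4)])
qed

lemma S_atLeast: assumes "0 \<le> w" "0 \<le> x" shows "S {w..} x = max 0 (x - w)"
proof -
  have "{w..} \<inter> {0..<x} = {w..<x}" using assms by auto
  then show ?thesis by (cases "w \<le> x") (simp_all add: S_def)
qed

lemma has_density_atLeast: assumes "0 \<le> c" shows "has_density {c..} 1"
proof (rule has_densityI_bounded[of _ c])
qed (use assms in \<open>auto simp: S_atLeast\<close>)

lemma atLeast_in_CC: "0 \<le> c \<Longrightarrow> {c..} \<in> CC"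
  using CC_iff MM_atLeast has_density_atLeast by blast

lemma thin_atLeast_0: "C \<in> MM \<Longrightarrow> thin C {0..} = C"
  using MM_nonneg by (auto simp: thin_def S_nonneg)

lemma lavg_thin:
  assumes C: "C \<in> MM" and c: "has_density C c" and A: "A \<in> MM"
  shows "((\<lambda>p. lavg (thin C A) p - c * lavg A p) \<longlongrightarrow> 0) windows"
proof (rule tendstoI)
  fix e :: real assume e: "0 < e"
  then obtain R where R: "0 \<le> R" "\<And>u. 0 \<le> u \<Longrightarrow> \<bar>S C u - c * u\<bar> \<le> (e / 2) * u + R"
    using c unfolding has_density_def by (metis half_gt_zero)
  have c01: "0 \<le> c" "c \<le> 1" using c by (auto simp: has_density_def)
  have "\<forall>\<^sub>F p in windows. \<bar>(R + 2 + \<bar>ln c\<bar>) / ln (snd p)\<bar> < e / 2"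
    using tendstoD[OF inverse_ln_windows, of "e / 2"] e by (simp add: dist_real_def)
  then show "\<forall>\<^sub>F p in windows. dist (lavg (thin C A) p - c * lavg A p) 0 < e"
    using eventually_windows_proper
  proof eventually_elim
    case (elim p)
    then have "\<bar>lavg (thin C A) p - c * lavg A p\<bar> \<le> e / 2 + (R + 2 + \<bar>ln c\<bar>) / ln (snd p)"
      using log_avg_thin[OF C A c01 R(1,2)] by (auto simp: lavg_def split: prod.splits)
    then show ?case using elim(1) unfolding dist_real_def by linarith
  qed
qed

lemma lavg_thin_limit:
  assumes "C \<in> MM" "has_density C c" "A \<in> MM" "G \<le> windows" "(lavg A \<longlongrightarrow> L) G"
  shows "(lavg (thin C A) \<longlongrightarrow> c * L) G"
proof -
  have "((\<lambda>p. lavg (thin C A) p - c * lavg A p) \<longlongrightarrow> 0) G"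
    by (rule tendsto_mono[OF assms(4) lavg_thin[OF assms(1-3)]])
  from tendsto_add[OF this tendsto_mult_left[OF assms(5), of c]] show ?thesis by simp
qed

lemma lavg_atLeast_0_limit: "G \<le> windows \<Longrightarrow> (lavg {0..} \<longlongrightarrow> 1) G"
proof (rule tendsto_mono[of G windows])
  show "(lavg {0..} \<longlongrightarrow> 1) windows"
    by (rule tendsto_eventually, rule eventually_mono[OF eventually_windows_proper])
       (auto simp: lavg_def log_avg_atLeast_0)
qed

lemma lavg_density_limit:
  assumes "C \<in> MM" "has_density C c" "G \<le> windows" shows "(lavg C \<longlongrightarrow> c) G"
  using lavg_thin_limit[OF assms(1,2) MM_atLeast assms(3) lavg_atLeast_0_limit] thin_atLeast_0 assms
  by fastforce

section \<open>Limits of averages are weakly thinnable\<close>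


lemma f_system_UNIV: assumes "f_system F" shows "{0..} \<in> F"
proof -
  obtain A where A: "A \<in> F" "A \<subseteq> {0..}" using assms unfolding f_system_def by blast
  then have "A \<union> ({0..} - A) \<in> F" using assms unfolding f_system_def by (meson Diff_disjoint)
  moreover have "A \<union> ({0..} - A) = {0..}" using A by auto
  ultimately show ?thesis by simp
qed

lemma f_system_MM: "f_system MM"
  unfolding f_system_def using MM_atLeast[of 0] MM_Un MM_Compl MM_nonneg by blast

text \<open>
Each axiom is an asymptotic property of averages over windows: they are finitely additive,
they respect the ordering by \<open>S\<close> up to \<open>2 / ln D\<close>, and thinning multiplies them by the density
up to an error that vanishes as \<open>D\<close> grows. Coherence holds because a linear combination of
averages is at most the supremum of the same combination of indicators.
\<close>
lemma limit_pair_in_WTC: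
  assumes G: "G \<le> windows" "G \<noteq> bot" and F: "f_system F" "F \<subseteq> MM"
    and thin: "\<And>C A. C \<in> CC \<Longrightarrow> A \<in> F \<Longrightarrow> thin C A \<in> F"
    and lim: "\<And>A. A \<in> F \<Longrightarrow> (lavg A \<longlongrightarrow> \<mu> A) G"
  shows "(F, \<mu>) \<in> WTC"
proof -
  have proper: "\<forall>\<^sub>F p in G. 1 < fst p \<and> 1 < snd p"
    by (rule eventually_mono[OF filter_leD[OF G(1) eventually_windows_proper]]) auto
  have MM: "A \<in> MM" if "A \<in> F" for A using that F by auto
  have UNIV: "{0..} \<in> F" by (rule f_system_UNIV[OF F(1)])
  have CF: "C \<in> F" if "C \<in> CC" for C
    using thin[OF that UNIV] that thin_atLeast_0 CC_iff by auto
  have dens: "\<mu> C = c" if "C \<in> CC" "has_density C c" for C c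
    by (rule tendsto_unique[OF G(2) lim[OF CF[OF that(1)]]])
       (use that CC_iff lavg_density_limit G in auto)
  have prob: "probability_measure_on F \<mu>"
    unfolding probability_measure_on_def
  proof (intro conjI ballI impI)
    fix A assume A: "A \<in> F"
    have "0 \<le> \<mu> A"
      by (rule tendsto_lowerbound[OF lim[OF A] _ G(2)], rule eventually_mono[OF proper])
         (auto simp: lavg_def log_avg_nonneg[OF MM[OF A]])
    moreover have "\<mu> A \<le> 1"
      by (rule tendsto_upperbound[OF lim[OF A] _ G(2)], rule eventually_mono[OF proper])
         (auto simp: lavg_def log_avg_le_1[OF MM[OF A]])
    ultimately show "\<mu> A \<in> {0..1}" by simp
  next
    show "\<mu> {0..} = 1" by (rule dens[OF atLeast_in_CC has_density_atLeast]) auto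
  next
    fix A B assume AB: "A \<in> F" "B \<in> F" "A \<inter> B = {}"
    then have "A \<union> B \<in> F" using F unfolding f_system_def by blast
    moreover have "(lavg (A \<union> B) \<longlongrightarrow> \<mu> A + \<mu> B) G"
    proof (rule Lim_transform_eventually[OF tendsto_add[OF lim[OF AB(1)] lim[OF AB(2)]]])
      show "\<forall>\<^sub>F p in G. lavg A p + lavg B p = lavg (A \<union> B) p"
        using proper by eventually_elim (auto simp: lavg_def log_avg_Un[OF MM[OF AB(1)] MM[OF AB(2)] AB(3)])
    qed
    ultimately show "\<mu> (A \<union> B) = \<mu> A + \<mu> B" using tendsto_unique[OF G(2) lim] by blast
  qed
  have P1: "\<mu> (thin C A) = \<mu> C * \<mu> A" if C: "C \<in> CC" and A: "A \<in> F" for C A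
  proof -
    obtain c where c: "has_density C c" using C CC_iff by blast
    have "(lavg (thin C A) \<longlongrightarrow> c * \<mu> A) G"
      using lavg_thin_limit[OF _ c MM[OF A] G(1) lim[OF A]] C CC_iff by blast
    then have "\<mu> (thin C A) = c * \<mu> A" using tendsto_unique[OF G(2) lim[OF thin[OF C A]]] by blast
    then show ?thesis using dens[OF C c] by simp
  qed
  have P2: "\<mu> B \<le> \<mu> A" if A: "A \<in> F" and B: "B \<in> F" and le: "\<forall>x\<in>{0..}. S B x \<le> S A x" for A B
  proof -
    have "((\<lambda>p. lavg A p + 2 / ln (snd p)) \<longlongrightarrow> \<mu> A + 0) G"
      by (intro tendsto_add lim[OF A] tendsto_mono[OF G(1) inverse_ln_windows])
    then have "\<mu> B \<le> \<mu> A + 0"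
    proof (rule tendsto_le[OF G(2) _ lim[OF B]])
      show "\<forall>\<^sub>F p in G. lavg B p \<le> lavg A p + 2 / ln (snd p)"
        using proper by eventually_elim
          (use log_avg_mono_S[OF MM[OF A] MM[OF B]] le in \<open>auto simp: lavg_def\<close>)
    qed
    then show ?thesis by simp
  qed
  have P3: "\<mu> {c..} = 1" if "0 \<le> c" for c
    by (rule dens[OF atLeast_in_CC has_density_atLeast]) (use that in auto)
  have coh: "coherent F \<mu>"
    unfolding coherent_def
  proof (intro allI impI)
    fix n and c :: "nat \<Rightarrow> real" and A :: "nat \<Rightarrow> real set"
    assume A: "\<forall>i\<in>{1..n}. A i \<in> F"
    define M where "M = (SUP x\<in>{0..}. \<Sum>i = 1..n. c i * (indicator (A i) x - \<mu> (A i)))"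
    have "bdd_above ((\<lambda>x. \<Sum>i = 1..n. c i * (indicator (A i) x - \<mu> (A i))) ` {0..})"
    proof (rule bdd_aboveI2)
      fix x :: real
      show "(\<Sum>i = 1..n. c i * (indicator (A i) x - \<mu> (A i))) \<le> (\<Sum>i = 1..n. \<bar>c i\<bar> * (1 + \<bar>\<mu> (A i)\<bar>))"
      proof (rule sum_mono)
        fix i
        have "c i * (indicator (A i) x - \<mu> (A i)) \<le> \<bar>c i\<bar> * \<bar>indicator (A i) x - \<mu> (A i)\<bar>"
          by (metis abs_ge_self abs_mult)
        also have "\<dots> \<le> \<bar>c i\<bar> * (1 + \<bar>\<mu> (A i)\<bar>)"
          by (rule mult_left_mono) (auto simp: indicator_def)
        finally show "c i * (indicator (A i) x - \<mu> (A i)) \<le> \<bar>c i\<bar> * (1 + \<bar>\<mu> (A i)\<bar>)" .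
      qed
    qed
    then have "(\<Sum>i = 1..n. c i * (indicator (A i) x - \<mu> (A i))) \<le> M" if "0 \<le> x" for x
      unfolding M_def using that by (intro cSUP_upper) auto
    then have le: "(\<Sum>i = 1..n. c i * indicator (A i) x) \<le> M + (\<Sum>i = 1..n. c i * \<mu> (A i))"
      if "0 \<le> x" for x
      using that by (simp add: right_diff_distrib sum_subtractf algebra_simps)
    have "((\<lambda>p. \<Sum>i = 1..n. c i * lavg (A i) p) \<longlongrightarrow> (\<Sum>i = 1..n. c i * \<mu> (A i))) G"
      using A by (intro tendsto_sum tendsto_mult_left lim) auto
    then have "(\<Sum>i = 1..n. c i * \<mu> (A i)) \<le> M + (\<Sum>i = 1..n. c i * \<mu> (A i))"
    proof (rule tendsto_upperbound[OF _ _ G(2)])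
      show "\<forall>\<^sub>F p in G. (\<Sum>i = 1..n. c i * lavg (A i) p) \<le> M + (\<Sum>i = 1..n. c i * \<mu> (A i))"
        using proper
      proof eventually_elim
        case (elim p)
        then show ?case
          using sum_log_avg_le[of "{1..n}" A "fst p" "snd p" c, OF _ _ _ _ le] A MM
          by (auto simp: lavg_def case_prod_beta)
      qed
    qed
    then show "0 \<le> (SUP x\<in>{0..}. \<Sum>i = 1..n. c i * (indicator (A i) x - \<mu> (A i)))"
      unfolding M_def by simp
  qed
  show ?thesis
    unfolding WTC_def WT_def probability_pair_def
    using F prob thin P1 P2 P3 coh by auto
qed

lemma WTC_subset_WT: "WTC \<subseteq> WT"
  by (auto simp: WTC_def)

text \<open>
The averages of all sets at one window form a point of a product of copies of the compact
interval \<open>[0, 1]\<close>, one for each set. Along \<open>H\<close> these points have a cluster point \<open>\<mu>\<close>, and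
intersecting \<open>H\<close> with the preimages of the neighbourhoods of \<open>\<mu>\<close> gives the refined filter.
\<close>
lemma limit_filter_exists:
  assumes H: "H \<le> windows" "H \<noteq> bot"
  obtains G \<mu> where "G \<le> H" "G \<noteq> bot" "\<And>A. A \<in> MM \<Longrightarrow> (lavg A \<longlongrightarrow> \<mu> A) G"
proof -
  \<comment> \<open>Clamping puts every window into the compact cube; eventually along the windows it changes nothing.\<close>
  define g where "g p A = max 0 (min 1 (lavg A p))" for p A
  define K :: "(real set \<Rightarrow> real) set" where "K = PiE UNIV (\<lambda>_. {0..1})"
  have "compactin (product_topology (\<lambda>_::real set. euclideanreal) UNIV) K"
    unfolding K_def compactin_PiE by simp
  then have "compact K" by (simp add: euclidean_product_topology)
  moreover have "filtermap g H \<noteq> bot" using H by (simp add: filtermap_bot_iff)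
  moreover have "eventually (\<lambda>f. f \<in> K) (filtermap g H)"
    by (auto simp: eventually_filtermap K_def g_def PiE_iff)
  ultimately obtain \<mu> where \<mu>: "inf (nhds \<mu>) (filtermap g H) \<noteq> bot"
    unfolding compact_filter by blast
  define G where "G = inf H (filtercomap g (nhds \<mu>))"
  have "G \<noteq> bot"
  proof
    assume "G = bot"
    then have "eventually (\<lambda>_. False) G" by simp
    then obtain P Q where P: "eventually P H" and Q: "eventually Q (nhds \<mu>)" and PQ: "\<And>p. P p \<Longrightarrow> Q (g p) \<Longrightarrow> False"
      unfolding G_def eventually_inf eventually_filtercomap by blast
    have "eventually (\<lambda>f. \<exists>p. P p \<and> g p = f) (filtermap g H)"
      unfolding eventually_filtermap by (rule eventually_mono[OF P]) blast
    with Q have "eventually (\<lambda>_. False) (inf (nhds \<mu>) (filtermap g H))"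
      unfolding eventually_inf using PQ by blast
    then show False using \<mu> by (simp add: trivial_limit_def)
  qed
  moreover have "(lavg A \<longlongrightarrow> \<mu> A) G" if A: "A \<in> MM" for A
  proof -
    have "filterlim g (nhds \<mu>) G"
      unfolding filterlim_iff_le_filtercomap G_def by simp
    then have "((\<lambda>p. g p A) \<longlongrightarrow> \<mu> A) G"
      using continuous_on_tendsto_compose[OF continuous_on_product_coordinates[of A]] by simp
    moreover have "\<forall>\<^sub>F p in G. g p A = lavg A p"
    proof -
      have "G \<le> windows" using H by (simp add: G_def le_infI1)
      from filter_leD[OF this eventually_windows_proper] show ?thesis
        by eventually_elim (auto simp: g_def lavg_def log_avg_nonneg[OF A] log_avg_le_1[OF A])
    qed
    ultimately show ?thesis by (rule Lim_transform_eventually)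
  qed
  ultimately show ?thesis by (intro that[of G \<mu>]) (auto simp: G_def)
qed

lemma MM_limit_pair:
  assumes "H \<le> windows" "H \<noteq> bot"
  obtains G \<mu> where "G \<le> H" "G \<noteq> bot" "\<And>A. A \<in> MM \<Longrightarrow> (lavg A \<longlongrightarrow> \<mu> A) G" "(MM, \<mu>) \<in> WTC"
proof -
  obtain G \<mu> where G: "G \<le> H" "G \<noteq> bot" "\<And>A. A \<in> MM \<Longrightarrow> (lavg A \<longlongrightarrow> \<mu> A) G"
    using limit_filter_exists[OF assms] by blast
  moreover have "(MM, \<mu>) \<in> WTC"
    by (rule limit_pair_in_WTC[of G]) (use G assms f_system_MM MM_thin CC_iff order_trans in auto)
  ultimately show ?thesis using that by blast
qed

lemma Auni_pair: "(Auni, alpha) \<in> WTC"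
proof (rule limit_pair_in_WTC[of windows])
  show "Auni \<subseteq> MM" using Auni_iff by blast
  have Un: "A \<union> B \<in> Auni" if "A \<in> Auni" "B \<in> Auni" "A \<inter> B = {}" for A B
  proof -
    have MM: "A \<in> MM" "B \<in> MM" using that Auni_iff by auto
    have "(lavg (A \<union> B) \<longlongrightarrow> alpha A + alpha B) windows"
    proof (rule Lim_transform_eventually[OF tendsto_add[OF alpha_limit[OF that(1)] alpha_limit[OF that(2)]]])
      show "\<forall>\<^sub>F p in windows. lavg A p + lavg B p = lavg (A \<union> B) p"
        using eventually_windows_proper
          by eventually_elim (auto simp: lavg_def log_avg_Un[OF MM that(3)])
    qed
    then show ?thesis using Auni_iff MM MM_Un by blast
  qed
  have Compl: "{0..} - A \<in> Auni" if "A \<in> Auni" for A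
  proof -
    have MM: "A \<in> MM" using that Auni_iff by auto
    have "(lavg ({0..} - A) \<longlongrightarrow> 1 - alpha A) windows"
    proof (rule Lim_transform_eventually[OF tendsto_diff[OF tendsto_const alpha_limit[OF that]]])
      show "\<forall>\<^sub>F p in windows. 1 - lavg A p = lavg ({0..} - A) p"
        using eventually_windows_proper by eventually_elim (auto simp: lavg_def log_avg_Compl[OF MM])
    qed
    then show ?thesis using Auni_iff MM MM_Compl by blast
  qed
  have "{0..} \<in> Auni" using Auni_iff MM_atLeast[of 0] lavg_atLeast_0_limit by blast
  moreover have "Auni \<subseteq> Pow {0..}" using Auni_iff MM_nonneg by blast
  ultimately show "f_system Auni" unfolding f_system_def using Un Compl by blast
  show "thin C A \<in> Auni" if "C \<in> CC" "A \<in> Auni" for C A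
    using that lavg_thin_limit MM_thin unfolding Auni_iff CC_iff by blast
qed (use alpha_limit windows_neq_bot in auto)

text \<open>
Let \<open>\<mu> A\<close> be a limit of averages of \<open>A\<close>. Since it is not a uniform limit, there are windows
with arbitrarily large ratio on which the average of \<open>A\<close> stays away from \<open>\<mu> A\<close>; a limit along
these windows is a second value.
\<close>
lemma not_Auni_two_pairs:
  assumes A: "A \<in> MM" "A \<notin> Auni"
  obtains \<mu> \<nu> where "(MM, \<mu>) \<in> WTC" "(MM, \<nu>) \<in> WTC" "\<mu> A \<noteq> \<nu> A"
proof -
  obtain G \<mu> where \<mu>: "(MM, \<mu>) \<in> WTC" using MM_limit_pair[OF order_refl windows_neq_bot] by blast
  have "\<not> (lavg A \<longlongrightarrow> \<mu> A) windows" using A Auni_iff by blast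
  then obtain e where e: "0 < e" "\<not> (\<forall>\<^sub>F p in windows. dist (lavg A p) (\<mu> A) < e)"
    unfolding tendsto_iff by blast
  define H where "H = inf windows (principal {p. e \<le> dist (lavg A p) (\<mu> A)})"
  have "H \<noteq> bot"
    using e(2) unfolding H_def trivial_limit_def eventually_inf_principal by (simp add: not_le)
  then obtain G \<nu> where G: "G \<le> H" "G \<noteq> bot" "\<And>A. A \<in> MM \<Longrightarrow> (lavg A \<longlongrightarrow> \<nu> A) G" and \<nu>: "(MM, \<nu>) \<in> WTC"
    using MM_limit_pair[of H] by (auto simp: H_def)
  have "\<forall>\<^sub>F p in G. e \<le> dist (lavg A p) (\<mu> A)"
    by (rule filter_leD[OF G(1)]) (simp add: H_def eventually_inf_principal)
  then have "e \<le> dist (\<nu> A) (\<mu> A)"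
    by (rule tendsto_lowerbound[OF tendsto_dist[OF G(3)[OF A(1)] tendsto_const] _ G(2)])
  then have "\<mu> A \<noteq> \<nu> A" using e by auto
  then show ?thesis using that \<mu> \<nu> by blast
qed

section \<open>Periodic sets\<close>

text \<open>
Sets of period 1: for disjoint subintervals \<open>{a..<b}\<close> of \<open>{0..<1}\<close> they are disjoint, and they
realise every density \<open>b - a\<close> with a counting function that is linear up to a bounded error.
\<close>
definition periodic :: "real \<Rightarrow> real \<Rightarrow> real set" where
  "periodic a b = (\<Union>j::nat. {real j + a ..< real j + b})"

lemma periodic_MM:
  assumes "0 \<le> a" "a \<le> b" "b \<le> 1" shows "periodic a b \<in> MM"
proof -
  define s where "s n = real (n div 2) + (if even n then a else b)" for n
  have "incseq s"
  proof (rule incseq_SucI)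
    fix n show "s n \<le> s (Suc n)" using assms by (cases "even n") (auto simp: s_def elim!: evenE oddE)
  qed
  moreover have "filterlim s at_top sequentially"
  proof (rule filterlim_at_top_mono)
    have "filterlim (\<lambda>n::nat. n div 2) sequentially sequentially"
      by (rule filterlim_at_top_div_const_nat) simp
    then show "filterlim (\<lambda>n. real (n div 2)) at_top sequentially"
      by (rule filterlim_compose[OF filterlim_real_sequentially])
    show "eventually (\<lambda>n. real (n div 2) \<le> s n) sequentially" using assms by (simp add: s_def)
  qed
  moreover have "periodic a b = (\<Union>i. {s (2 * i) ..< s (2 * i + 1)})"
    by (simp add: periodic_def s_def)
  moreover have "0 \<le> s 0" using assms by (simp add: s_def)
  ultimately show ?thesis unfolding MM_def by blast
qed

lemma periodic_cell:
  assumes "0 \<le> a" "b \<le> 1"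
  shows "periodic a b \<inter> {real n..<real n + 1} = {real n + a..<real n + b}"
proof (intro equalityI subsetI)
  fix x assume "x \<in> periodic a b \<inter> {real n..<real n + 1}"
  then obtain j :: nat where j: "real j + a \<le> x" "x < real j + b" "real n \<le> x" "x < real n + 1"
    by (auto simp: periodic_def)
  then have "real j < real n + 1" "real n < real j + 1" using assms by linarith+
  then have "j = n" by linarith
  then show "x \<in> {real n + a..<real n + b}" using j by simp
qed (use assms in \<open>auto simp: periodic_def\<close>)

lemma S_periodic_nat:
  assumes "0 \<le> a" "a \<le> b" "b \<le> 1" shows "S (periodic a b) (real n) = real n * (b - a)"
proof (induction n)
  case (Suc n)
  have "S (periodic a b) (real n + 1)
      = S (periodic a b) (real n) + measure lborel (periodic a b \<inter> {real n..<real n + 1})"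
    by (rule S_add) (use MM_borel[OF periodic_MM[OF assms]] in auto)
  then show ?case using Suc periodic_cell[of a b n] assms by (simp add: algebra_simps)
qed simp

lemma S_periodic:
  assumes "0 \<le> a" "a \<le> b" "b \<le> 1" "0 \<le> x" shows "\<bar>S (periodic a b) x - (b - a) * x\<bar> \<le> 1"
proof -
  note P = MM_borel[OF periodic_MM[OF assms(1-3)]]
  define n where "n = nat \<lfloor>x\<rfloor>"
  have n: "real n \<le> x" "x \<le> real (Suc n)" using assms(4) by (auto simp: n_def) linarith
  have "S (periodic a b) (real n) \<le> S (periodic a b) x"
    "S (periodic a b) x \<le> S (periodic a b) (real (Suc n))"
    using S_mono[OF P] n assms(4) by auto
  then have "real n * (b - a) \<le> S (periodic a b) x" "S (periodic a b) x \<le> real (Suc n) * (b - a)"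
    unfolding S_periodic_nat[OF assms(1-3)] by auto
  moreover have "real n * (b - a) \<le> x * (b - a)" "x * (b - a) \<le> real (Suc n) * (b - a)"
    using n assms by (auto intro: mult_right_mono)
  moreover have "real (Suc n) * (b - a) = real n * (b - a) + (b - a)" by (simp add: algebra_simps)
  ultimately show ?thesis using assms by (simp add: mult.commute abs_le_iff)
qed

lemma has_density_periodic:
  "0 \<le> a \<Longrightarrow> a \<le> b \<Longrightarrow> b \<le> 1 \<Longrightarrow> has_density (periodic a b) (b - a)"
  by (rule has_densityI_bounded[of _ 1]) (use S_periodic in auto)

lemma periodic_CC: "0 \<le> a \<Longrightarrow> a \<le> b \<Longrightarrow> b \<le> 1 \<Longrightarrow> periodic a b \<in> CC"
  using CC_iff periodic_MM has_density_periodic by blast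

lemma periodic_Un:
  assumes "a \<le> b" "b \<le> c" shows "periodic a b \<union> periodic b c = periodic a c"
proof -
  have "{real j + a..<real j + c} = {real j + a..<real j + b} \<union> {real j + b..<real j + c}" for j
    using assms by auto
  then show ?thesis by (auto simp: periodic_def)
qed

lemma periodic_disjoint:
  assumes "0 \<le> a" "b \<le> c" "d \<le> 1" "a \<le> b" "c \<le> d" shows "periodic a b \<inter> periodic c d = {}"
proof (rule ccontr)
  assume "periodic a b \<inter> periodic c d \<noteq> {}"
  then obtain x i j where *: "real i + a \<le> x" "x < real i + b" "real j + c \<le> x" "x < real j + d"
    by (auto simp: periodic_def)
  then have "real i < real j + 1" "real j < real i + 1" using assms by linarith+
  then have "i = j" by linarith
  then have "real i = real j" by simp
  then show False using * assms by linarith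
qed

lemma periodic_0_1: "periodic 0 1 = {0..}"
proof (intro equalityI subsetI)
  fix x :: real assume "x \<in> {0..}"
  then have "real (nat \<lfloor>x\<rfloor>) \<le> x" "x < real (nat \<lfloor>x\<rfloor>) + 1" by simp_all
  then show "x \<in> periodic 0 1" by (auto simp: periodic_def)
qed (auto simp: periodic_def)

lemma periodic_empty: "periodic a a = {}"
  by (simp add: periodic_def)

lemma rho_integral_ge:
  assumes "A \<in> sets borel" "0 < x" "x \<le> y" shows "S A x * (1 / x - 1 / y) \<le> rho_integral A x y"
proof -
  have "(\<lambda>u. - S A u / u\<^sup>2) integrable_on {x..y}"
    using integrable_neg[OF rho_integral_integrable[OF assms(1,2)]] by simp
  then have "integral {x..y} (\<lambda>u. - S A u / u\<^sup>2) \<le> 0 * ln (y / x) + (- S A x) * (1 / x - 1 / y)"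
    by (rule integral_over_square_le[OF assms(2,3)]) (use S_mono assms in auto)
  then show ?thesis by (simp add: rho_integral_def)
qed

section \<open>Uniqueness for weakly thinnable pairs\<close>


locale weakly_thinnable =
  fixes F :: "real set set" and \<mu> :: "real set \<Rightarrow> real"
  assumes WT: "(F, \<mu>) \<in> WT"
begin

lemma f_system: "f_system F" and subset_MM: "F \<subseteq> MM"
  using WT by (auto simp: WT_def probability_pair_def)

lemma F_in_MM: "A \<in> F \<Longrightarrow> A \<in> MM" using subset_MM by auto

lemma UNIV_F: "{0..} \<in> F" by (rule f_system_UNIV[OF f_system])

lemma Un_F: "A \<in> F \<Longrightarrow> B \<in> F \<Longrightarrow> A \<inter> B = {} \<Longrightarrow> A \<union> B \<in> F"
  and Compl_F: "A \<in> F \<Longrightarrow> {0..} - A \<in> F"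
  using f_system by (auto simp: f_system_def)

lemma \<mu>_le_1: "A \<in> F \<Longrightarrow> \<mu> A \<le> 1"
  and \<mu>_nonneg: "A \<in> F \<Longrightarrow> 0 \<le> \<mu> A"
  and \<mu>_UNIV: "\<mu> {0..} = 1"
  and \<mu>_Un: "A \<in> F \<Longrightarrow> B \<in> F \<Longrightarrow> A \<inter> B = {} \<Longrightarrow> \<mu> (A \<union> B) = \<mu> A + \<mu> B"
  using WT by (auto simp: WT_def probability_pair_def probability_measure_on_def)

lemma thin_F: "C \<in> CC \<Longrightarrow> A \<in> F \<Longrightarrow> thin C A \<in> F"
  and \<mu>_thin: "C \<in> CC \<Longrightarrow> A \<in> F \<Longrightarrow> \<mu> (thin C A) = \<mu> C * \<mu> A"
  and \<mu>_mono: "A \<in> F \<Longrightarrow> B \<in> F \<Longrightarrow> (\<And>x. 0 \<le> x \<Longrightarrow> S A x \<le> S B x) \<Longrightarrow> \<mu> A \<le> \<mu> B"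
  and \<mu>_atLeast: "0 \<le> c \<Longrightarrow> \<mu> {c..} = 1"
  using WT by (auto simp: WT_def)

lemma CC_F: "C \<in> CC \<Longrightarrow> C \<in> F"
  using thin_F[OF _ UNIV_F] thin_atLeast_0 CC_iff by fastforce

lemma \<mu>_Compl: assumes "A \<in> F" shows "\<mu> ({0..} - A) = 1 - \<mu> A"
proof -
  have "A \<union> ({0..} - A) = {0..}" using MM_nonneg[OF F_in_MM[OF assms]] by auto
  then show ?thesis using \<mu>_Un[OF assms Compl_F[OF assms]] \<mu>_UNIV by auto
qed

lemma empty_F: "{} \<in> F" and \<mu>_empty: "\<mu> {} = 0"
  using Compl_F[OF UNIV_F] \<mu>_Compl[OF UNIV_F] \<mu>_UNIV by auto

text \<open>
Thinning by \<open>{w..}\<close> translates \<open>A\<close> to the right by \<open>w\<close> and leaves its measure unchanged. A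
sufficiently long delay absorbs any additive constant, so that only the linear growth
rates of the counting functions matter.
\<close>
lemma \<mu>_le_of_growth:
  assumes A: "A \<in> F" and B: "B \<in> F" and c: "0 < c" and K: "0 \<le> K"
    and up: "\<And>x. 0 \<le> x \<Longrightarrow> S A x \<le> c * x + K"
    and low: "\<And>x. 0 \<le> x \<Longrightarrow> c * x - K \<le> S B x"
  shows "\<mu> A \<le> \<mu> B"
proof -
  \<comment> \<open>During the delay \<open>w\<close> a set of density \<open>c\<close> gains \<open>c * w = 2 * K\<close>, which covers the error \<open>K\<close> on either side.\<close>
  define w where "w = 2 * K / c"
  have w: "0 \<le> w" "c * w = 2 * K" using c K by (auto simp: w_def)
  have "\<mu> (thin {w..} A) \<le> \<mu> B"
  proof (rule \<mu>_mono[OF thin_F[OF atLeast_in_CC[OF w(1)] A] B])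
    fix x :: real assume x: "0 \<le> x"
    have "S (thin {w..} A) x = S A (max 0 (x - w))"
      using S_thin[OF _ MM_borel[OF F_in_MM[OF A]] x, of "{w..}"] S_atLeast[OF w(1) x] by simp
    also have "\<dots> \<le> S B x"
    proof (cases "x \<le> w")
      case True then show ?thesis by (simp add: max_absorb1 S_nonneg)
    next
      case False
      then have "S A (x - w) \<le> c * x - K" using up[of "x - w"] w by (simp add: right_diff_distrib)
      then show ?thesis using low[OF x] False by (simp add: max_absorb2)
    qed
    finally show "S (thin {w..} A) x \<le> S B x" .
  qed
  then show ?thesis using \<mu>_thin[OF atLeast_in_CC[OF w(1)] A] \<mu>_atLeast[OF w(1)] by simp
qed

text \<open>
By \<open>\<mu>_le_of_growth\<close>, the \<open>n\<close> translates of a periodic set of density \<open>1 / n\<close> have equal measure;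
as they partition the half-line, that measure is \<open>1 / n\<close>.
\<close>
lemma \<mu>_periodic_rational:
  assumes "0 < n" "k \<le> n" shows "\<mu> (periodic 0 (real k / real n)) = real k / real n"
proof -
  define cell where "cell i = periodic (real i / real n) (real (Suc i) / real n)" for i
  have frac: "0 \<le> real i / real n" "real i / real n \<le> real (Suc i) / real n"
      "real (Suc i) / real n - real i / real n = 1 / real n" for i
    using assms(1) by (auto simp: divide_simps)
  have le1: "real (Suc i) / real n \<le> 1" if "i < n" for i using that by simp
  have cellF: "cell i \<in> F" if "i < n" for i
    unfolding cell_def by (rule CC_F[OF periodic_CC[OF frac(1,2) le1[OF that]]])
  have Sc: "\<bar>S (cell i) x - 1 / real n * x\<bar> \<le> 1" if "i < n" "0 \<le> x" for i x
    using S_periodic[OF frac(1,2) le1[OF that(1)] that(2)] unfolding cell_def frac(3) .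
  have le: "\<mu> (cell i) \<le> \<mu> (cell j)" if "i < n" "j < n" for i j
    by (rule \<mu>_le_of_growth[OF cellF[OF that(1)] cellF[OF that(2)], of "1 / real n" 1])
       (use Sc[OF that(1)] Sc[OF that(2)] assms(1) in \<open>auto simp: abs_le_iff\<close>, smt+)
  then have eq: "\<mu> (cell i) = \<mu> (cell 0)" if "i < n" for i
    by (intro antisym le) (use that assms(1) in auto)
  have sum: "m \<le> n \<Longrightarrow> \<mu> (periodic 0 (real m / real n)) = real m * \<mu> (cell 0)" for m
  proof (induction m)
    case 0 then show ?case by (simp add: periodic_empty \<mu>_empty)
  next
    case (Suc m)
    have "periodic 0 (real m / real n) \<in> F"
      by (rule CC_F[OF periodic_CC]) (use Suc in auto)
    moreover have "periodic 0 (real m / real n) \<inter> cell m = {}"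
      unfolding cell_def by (rule periodic_disjoint) (use Suc frac le1[of m] in auto)
    ultimately have "\<mu> (periodic 0 (real m / real n) \<union> cell m) = real m * \<mu> (cell 0) + \<mu> (cell 0)"
      using \<mu>_Un cellF[of m] eq[of m] Suc by simp
    then show ?case
      unfolding cell_def using periodic_Un[OF frac(1,2)] by (simp add: algebra_simps)
  qed
  have "real n * \<mu> (cell 0) = 1" using sum[of n] assms(1) periodic_0_1 \<mu>_UNIV by simp
  then have "\<mu> (cell 0) = 1 / real n" using assms(1) by (simp add: field_simps)
  then show ?thesis using sum[OF assms(2)] by simp
qed

text \<open>
Compare \<open>A\<close> with a periodic set of rational density slightly above \<open>c\<close>.
\<close>
lemma \<mu>_le_growth_rate:
  assumes A: "A \<in> F" and c: "0 \<le> c" and K: "0 \<le> K" and up: "\<And>x. 0 \<le> x \<Longrightarrow> S A x \<le> c * x + K"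
  shows "\<mu> A \<le> c"
proof (cases "c < 1")
  case False
  then show ?thesis using \<mu>_le_1[OF A] by simp
next
  case True
  show ?thesis
  proof (rule field_le_epsilon)
    fix e :: real assume "0 < e"
    then obtain n :: nat where n: "0 < n" "1 / real n < e"
      using reals_Archimedean[of e] by (metis inverse_eq_divide zero_less_Suc)
    define k where "k = nat \<lfloor>c * real n\<rfloor> + 1"
    have cn: "0 \<le> c * real n" "c * real n < real n" using c True n by auto
    then have "\<lfloor>c * real n\<rfloor> < int n" by (simp add: floor_less_iff)
    then have kn: "k \<le> n" using n(1) by (auto simp: k_def)
    have k: "c * real n \<le> real k" "real k \<le> c * real n + 1" using cn(1) by (auto simp: k_def) linarith
    have ck: "c \<le> real k / real n" "real k / real n \<le> c + 1 / real n"
      using k n(1) by (auto simp: field_simps)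
    have "\<mu> A \<le> \<mu> (periodic 0 (real k / real n))"
    proof (rule \<mu>_le_of_growth[OF A, of _ "real k / real n" "max K 1"])
      show "periodic 0 (real k / real n) \<in> F" by (rule CC_F[OF periodic_CC]) (use kn n(1) in auto)
      show "0 < real k / real n" using n(1) by (simp add: k_def)
      fix x :: real assume x: "0 \<le> x"
      have "c * x \<le> real k / real n * x" using ck(1) x by (rule mult_right_mono)
      then show "S A x \<le> real k / real n * x + max K 1" using up[OF x] by linarith
      have "\<bar>S (periodic 0 (real k / real n)) x - (real k / real n - 0) * x\<bar> \<le> 1"
        by (rule S_periodic) (use kn n(1) x in auto)
      then have "\<bar>S (periodic 0 (real k / real n)) x - real k / real n * x\<bar> \<le> 1" by simp
      then show "real k / real n * x - max K 1 \<le> S (periodic 0 (real k / real n)) x" by linarith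
    qed (use K in auto)
    then show "\<mu> A \<le> c + e" using \<mu>_periodic_rational[OF n(1) kn] ck(2) n(2) by linarith
  qed
qed

lemma \<mu>_density:
  assumes C: "C \<in> CC" and c: "has_density C c" shows "\<mu> C = c"
proof (rule antisym; rule field_le_epsilon)
  fix e :: real assume e: "0 < e"
  obtain R where R: "0 \<le> R" "\<And>u. 0 \<le> u \<Longrightarrow> \<bar>S C u - c * u\<bar> \<le> e * u + R" and c01: "0 \<le> c" "c \<le> 1"
    using c e unfolding has_density_def by metis
  have CM: "C \<in> MM" using C CC_iff by blast
  show "\<mu> C \<le> c + e"
  proof (rule \<mu>_le_growth_rate[OF CC_F[OF C] _ R(1)])
    fix u :: real assume "0 \<le> u"
    then show "S C u \<le> (c + e) * u + R" using R(2)[of u] by (simp add: distrib_right abs_le_iff)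
  qed (use c01 e in auto)
  have "\<mu> ({0..} - C) \<le> 1 - c + e"
  proof (rule \<mu>_le_growth_rate[OF Compl_F[OF CC_F[OF C]] _ R(1)])
    fix u :: real assume u: "0 \<le> u"
    then have "S ({0..} - C) u = u - S C u" using S_Compl MM_borel MM_nonneg CM by blast
    then show "S ({0..} - C) u \<le> (1 - c + e) * u + R"
      using R(2)[OF u] by (simp add: algebra_simps abs_le_iff)
  qed (use c01 e in auto)
  then show "c \<le> \<mu> C + e" using \<mu>_Compl[OF CC_F[OF C]] by simp
qed

text \<open>
Split \<open>{0..<1}\<close> into consecutive intervals of lengths \<open>1 / (k H)\<close> for \<open>k = 2, \<dots>, N\<close>; they fit,
since the sum of \<open>1 / k\<close> over this range is at most \<open>H = ln N\<close>. The set \<open>B\<close> is the union of the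
thinnings of \<open>A\<close> by the corresponding disjoint periodic sets. With \<open>K = y / H\<close>, the thinning
number \<open>k\<close> contributes about \<open>S A (K / k)\<close> to \<open>S B y\<close>, and by monotonicity of \<open>S A\<close> this is at
most \<open>K\<close> times the integral of \<open>S A u / u\<^sup>2\<close> from \<open>K / k\<close> to \<open>K / (k - 1)\<close>, because the integral
of \<open>1 / u\<^sup>2\<close> over that interval is \<open>1 / K\<close>. The integrals telescope. The partial sums are
\<open>(harm m - 1) / H\<close>, since the range starts at \<open>k = 2\<close>.
\<close>
lemma harmonic_mixture:
  assumes A: "A \<in> F" and N: "1 < N"
  defines "H \<equiv> ln (real N)"
  assumes m: "1 \<le> m" "m \<le> N"
  shows "\<exists>B\<in>F. B \<subseteq> periodic 0 ((harm m - 1) / H) \<and> \<mu> B = (harm m - 1) / H * \<mu> A \<and>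
    (\<forall>y>0. S B y \<le> y / H * rho_integral A (y / H / real m) (y / H) + real m)"
  using m
proof (induction m rule: dec_induct)
  case base
  have "0 \<le> y / H * rho_integral A (y / H / real 1) (y / H)" if "0 < y" for y
    using that N by (intro mult_nonneg_nonneg rho_integral_nonneg) (simp add: H_def)
  then have "\<forall>y>0. S {} y \<le> y / H * rho_integral A (y / H / real 1) (y / H) + real 1"
    by (simp add: S_def add_nonneg_nonneg)
  then show ?case
    by (intro bexI[OF _ empty_F]) (simp add: harm_def \<mu>_empty)
next
  case (step m)
  have H: "0 < H" using N by (simp add: H_def)
  note Ab = MM_borel[OF F_in_MM[OF A]]
  define s where "s m = (harm m - 1) / H" for m :: nat
  have sS: "s (Suc m) = s m + 1 / (real (Suc m) * H)"
    unfolding s_def harm_Suc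
    by (simp add: diff_divide_distrib add_divide_distrib inverse_eq_divide del: of_nat_Suc)
  have s0: "0 \<le> s m"
  proof -
    have "(harm 1 :: real) \<le> harm m" by (rule harm_mono[OF step(1)])
    moreover have "(harm 1 :: real) = 1" by (simp add: harm_def)
    ultimately show ?thesis using H by (simp add: s_def)
  qed
  have "harm (Suc m) \<le> (harm N :: real)" by (rule harm_mono) (use step in auto)
  also have "\<dots> \<le> H + 1"
    using euler_mascheroni_sequence_decreasing[of 1 N] N by (simp add: H_def harm_def)
  finally have s1: "s (Suc m) \<le> 1" using H by (simp add: s_def)
  have sle: "s m \<le> s (Suc m)" using sS H by simp
  define C where "C = periodic (s m) (s (Suc m))"
  have C: "C \<in> CC" unfolding C_def by (rule periodic_CC[OF s0 sle s1])
  have \<mu>C: "\<mu> C = 1 / (real (Suc m) * H)"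
    using \<mu>_density[OF C] has_density_periodic[OF s0 sle s1] sS unfolding C_def by simp
  obtain B where B: "B \<in> F" "B \<subseteq> periodic 0 (s m)" "\<mu> B = s m * \<mu> A"
      and SB: "\<And>y. 0 < y \<Longrightarrow> S B y \<le> y / H * rho_integral A (y / H / real m) (y / H) + real m"
    using step.IH[OF Suc_leD[OF step.prems]] unfolding s_def by blast
  have thF: "thin C A \<in> F" by (rule thin_F[OF C A])
  have disj: "B \<inter> thin C A = {}"
  proof -
    have "periodic 0 (s m) \<inter> C = {}" unfolding C_def by (rule periodic_disjoint) (use s0 s1 sle in auto)
    then show ?thesis using B(2) by (auto simp: thin_def)
  qed
  show ?case
  proof (intro bexI conjI allI impI)
    show "B \<union> thin C A \<in> F" by (rule Un_F[OF B(1) thF disj])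
    have "periodic 0 (s m) \<union> C = periodic 0 (s (Suc m))"
      unfolding C_def by (rule periodic_Un[OF s0 sle])
    then show "B \<union> thin C A \<subseteq> periodic 0 ((harm (Suc m) - 1) / H)"
      using B(2) unfolding s_def[symmetric] by (auto simp: thin_def)
    show "\<mu> (B \<union> thin C A) = (harm (Suc m) - 1) / H * \<mu> A"
      using \<mu>_Un[OF B(1) thF disj] \<mu>_thin[OF C A] B(3) \<mu>C sS
      unfolding s_def[symmetric] by (simp add: distrib_right)
    fix y :: real assume y: "0 < y"
    define K where "K = y / H"
    have K: "0 < K" using y H by (simp add: K_def)
    have m: "0 < real m" using step(1) by simp
    have KK: "K / real (Suc m) \<le> K / real m" "K / real m \<le> K" "0 < K / real (Suc m)"
      using K m step(1) by (auto simp: divide_simps mult_le_cancel_left)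
    have "S (thin C A) y = S A (S C y)"
      by (rule S_thin) (use y Ab C CC_iff MM_borel in auto)
    also have "\<dots> \<le> S A (K / real (Suc m)) + 1"
    proof -
      have "\<bar>S C y - (s (Suc m) - s m) * y\<bar> \<le> 1"
        unfolding C_def by (rule S_periodic[OF s0 sle s1]) (use y in simp)
      then have "\<bar>S C y - K / real (Suc m)\<bar> \<le> 1" unfolding sS K_def by (simp add: mult.commute)
      then show ?thesis using S_lipschitz[OF Ab S_nonneg[of C y], of "K / real (Suc m)"] KK(3)
        by linarith
    qed
    also have "S A (K / real (Suc m)) \<le> K * rho_integral A (K / real (Suc m)) (K / real m)"
    proof -
      have "1 / (K / real (Suc m)) - 1 / (K / real m) = 1 / K" using K m by (simp add: field_simps)
      then have "S A (K / real (Suc m)) * (1 / K) \<le> rho_integral A (K / real (Suc m)) (K / real m)"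
        using rho_integral_ge[OF Ab KK(3,1)] by simp
      then show ?thesis using K by (simp add: field_simps)
    qed
    finally have "S (thin C A) y \<le> K * rho_integral A (K / real (Suc m)) (K / real m) + 1" by simp
    moreover have "S B y \<le> K * rho_integral A (K / real m) K + real m" using SB[OF y]
      by (simp add: K_def)
    moreover have "S (B \<union> thin C A) y = S B y + S (thin C A) y"
      by (rule S_Un[OF _ _ disj]) (use B(1) thF F_in_MM MM_borel in auto)
    moreover have "rho_integral A (K / real (Suc m)) K
        = rho_integral A (K / real (Suc m)) (K / real m) + rho_integral A (K / real m) K"
      by (rule rho_integral_combine[OF Ab KK(3,1,2), symmetric])
    ultimately show "S (B \<union> thin C A) y
        \<le> y / H * rho_integral A (y / H / real (Suc m)) (y / H) + real (Suc m)"
      unfolding K_def[symmetric] by (simp add: distrib_left)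
  qed
qed

text \<open>
The mixture has measure at least \<open>(1 - 1 / ln N) * \<mu> A\<close>, while its counting function at \<open>y\<close> is
at most \<open>y\<close> times the average of \<open>A\<close> over a window of ratio \<open>N\<close>, up to an error \<open>y / ln N\<close> and a
constant. Once that window starts beyond 1, its average is at most \<open>L + e\<close>.
\<close>
lemma \<mu>_le_uniform_limit:
  assumes A: "A \<in> F" and lim: "(lavg A \<longlongrightarrow> L) windows"
  shows "\<mu> A \<le> L"
proof (rule field_le_epsilon)
  fix e' :: real assume e': "0 < e'"
  define e where "e = e' / 3"
  have e: "0 < e" using e' by (simp add: e_def)
  note AM = F_in_MM[OF A] and Ab = MM_borel[OF F_in_MM[OF A]]
  have L0: "0 \<le> L"
    by (rule tendsto_lowerbound[OF lim _ windows_neq_bot], rule eventually_mono[OF eventually_windows_proper])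
       (auto simp: lavg_def log_avg_nonneg[OF AM])
  have "\<forall>\<^sub>F p in windows. lavg A p < L + e \<and> 1 / ln (snd p) < e"
    using order_tendstoD(2)[OF lim, of "L + e"] order_tendstoD(2)[OF inverse_ln_windows, of e 1] e
    by (auto intro: eventually_conj)
  then have "\<forall>\<^sub>F D in at_top. \<forall>x>1. log_avg A x D < L + e \<and> 1 / ln D < e"
    unfolding eventually_windows by (simp add: lavg_def)
  then have "\<forall>\<^sub>F n in sequentially. \<forall>x>1. log_avg A x (real n) < L + e \<and> 1 / ln (real n) < e"
    by (rule eventually_compose_filterlim[OF _ filterlim_real_sequentially])
  then have "\<forall>\<^sub>F n in sequentially. (\<forall>x>1. log_avg A x (real n) < L + e \<and> 1 / ln (real n) < e) \<and> 1 < n"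
    by (rule eventually_conj[OF _ eventually_gt_at_top])
  then obtain N :: nat where N': "\<forall>x>1. log_avg A x (real N) < L + e \<and> 1 / ln (real N) < e" and N1: "1 < N"
    using eventually_happens'[OF sequentially_bot] by blast
  then have N: "1 < N" "\<And>x. 1 < x \<Longrightarrow> log_avg A x (real N) < L + e" "1 / ln (real N) < e"
    using N'[rule_format, of 2] by auto
  define H where "H = ln (real N)"
  have H: "0 < H" using N(1) by (simp add: H_def)
  obtain B where B: "B \<in> F" "\<mu> B = (harm N - 1) / H * \<mu> A"
      and SB: "\<And>y. 0 < y \<Longrightarrow> S B y \<le> y / H * rho_integral A (y / H / real N) (y / H) + real N"
    using harmonic_mixture[OF A N(1), of N] N(1) unfolding H_def by auto
  \<comment> \<open>The constant covers the range \<open>y \<le> N * H\<close>, in which the window would start below 1.\<close>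
  have "\<mu> B \<le> L + 2 * e"
  proof (rule \<mu>_le_growth_rate[OF B(1), of _ "real N * H + real N"])
    fix y :: real assume y0: "0 \<le> y"
    have Ly: "0 \<le> (L + 2 * e) * y" using L0 e y0 by simp
    show "S B y \<le> (L + 2 * e) * y + (real N * H + real N)"
    proof (cases "y \<le> real N * H")
      case True
      then show ?thesis using S_le[OF MM_borel[OF F_in_MM[OF B(1)]] y0] Ly by linarith
    next
      case False
      then have y: "0 < y" using H N(1)
        by (meson le_less_trans mult_nonneg_nonneg less_imp_le of_nat_0_le_iff not_le)
      define x where "x = y / H / real N"
      have x: "1 < x" "x * real N = y / H" using False H N(1) by (auto simp: x_def field_simps)
      have bd: "0 \<le> S A u / u" "S A u / u \<le> 1" if "0 < u" for u
        using S_nonneg S_le[OF Ab, of u] that by auto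
      have "H * log_avg A x (real N)
          = S A (x * real N) / (x * real N) - S A x / x + rho_integral A x (x * real N)"
        unfolding H_def by (rule log_avg_eq[OF AM]) (use x N(1) in auto)
      moreover have "H * log_avg A x (real N) \<le> H * (L + e)"
        using N(2)[OF x(1)] H by (intro mult_left_mono) auto
      moreover have "0 \<le> S A (x * real N) / (x * real N)" "S A x / x \<le> 1"
        by (rule bd(1)[of "x * real N"] bd(2)[of x], use x(1) N(1) in simp)+
      ultimately have "rho_integral A x (y / H) \<le> H * (L + e) + 1" unfolding x(2) by linarith
      then have "y / H * rho_integral A x (y / H) \<le> y / H * (H * (L + e) + 1)"
        using y H by (intro mult_left_mono) auto
      also have "\<dots> = y * (L + e) + y * (1 / H)" using H by (simp add: field_simps)
      also have "y * (1 / H) \<le> y * e" using N(3) y by (intro mult_left_mono) (auto simp: H_def)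
      finally have "y / H * rho_integral A x (y / H) \<le> (L + 2 * e) * y" by (simp add: algebra_simps)
      moreover have "0 \<le> real N * H" using H by simp
      ultimately show ?thesis using SB[OF y] unfolding x_def by linarith
    qed
  qed (use L0 e H in auto)
  moreover have "(1 - e) * \<mu> A \<le> (harm N - 1) / H * \<mu> A"
  proof (rule mult_right_mono[OF _ \<mu>_nonneg[OF A]])
    have "ln (real N) \<le> ln (real N + 1)" using N(1) by simp
    also have "\<dots> \<le> harm N" by (rule ln_le_harm)
    finally have "(H - 1) / H \<le> (harm N - 1) / H" using H by (simp add: H_def divide_right_mono)
    moreover have "(H - 1) / H = 1 - 1 / H" using H by (simp add: field_simps)
    ultimately show "1 - e \<le> (harm N - 1) / H" using N(3) by (simp add: H_def)
  qed
  moreover have "e * \<mu> A \<le> e" using \<mu>_le_1[OF A] e by simp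
  ultimately have "\<mu> A \<le> L + 3 * e" unfolding B(2) by (simp add: left_diff_distrib)
  then show "\<mu> A \<le> L + e'" by (simp add: e_def)
qed

lemma \<mu>_eq_alpha:
  assumes A: "A \<in> F" "A \<in> Auni" shows "\<mu> A = alpha A"
proof (rule antisym)
  have lim: "(lavg A \<longlongrightarrow> alpha A) windows" by (rule alpha_limit[OF A(2)])
  show "\<mu> A \<le> alpha A" by (rule \<mu>_le_uniform_limit[OF A(1) lim])
  have "(lavg ({0..} - A) \<longlongrightarrow> 1 - alpha A) windows"
  proof (rule Lim_transform_eventually[OF tendsto_diff[OF tendsto_const lim]])
    show "\<forall>\<^sub>F p in windows. 1 - lavg A p = lavg ({0..} - A) p"
      using eventually_windows_proper
      by eventually_elim (auto simp: lavg_def log_avg_Compl[OF F_in_MM[OF A(1)]])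
  qed
  then have "\<mu> ({0..} - A) \<le> 1 - alpha A" by (rule \<mu>_le_uniform_limit[OF Compl_F[OF A(1)]])
  then show "alpha A \<le> \<mu> A" using \<mu>_Compl[OF A(1)] by simp
qed

end

section \<open>The canonical pair\<close>


lemma canonicalD:
  assumes "canonical P (F, \<mu>)" "A \<in> F" "(F', \<nu>) \<in> P" "A \<in> F'"
  shows "\<mu> A = \<nu> A"
proof -
  have "case (F', \<nu>) of (F', \<nu>) \<Rightarrow> A \<in> F' \<longrightarrow> \<mu> A = \<nu> A"
    using assms(1,2,3) unfolding canonical_def case_prod_conv[of _ F] by blast
  then show ?thesis using assms(4) by simp
qed

theorem theorem1p6:
  "((Auni, alpha) \<in> WT
      \<and> (\<exists>\<mu>. (MM, \<mu>) \<in> WT \<and> (\<forall>A\<in>Auni. \<mu> A = alpha A))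
      \<and> coherent Auni alpha)
   \<and> (canonical WT (Auni, alpha) \<and> canonical WTC (Auni, alpha))
   \<and> (\<forall>F \<mu>. canonical WT (F, \<mu>) \<or> canonical WTC (F, \<mu>) \<longrightarrow> F \<subseteq> Auni)"
proof (intro conjI allI impI subsetI)
  have eq: "\<nu> A = alpha A" if "(F, \<nu>) \<in> WT" "A \<in> F" "A \<in> Auni" for F \<nu> A
    using weakly_thinnable.\<mu>_eq_alpha[OF weakly_thinnable.intro] that by blast
  show WT: "(Auni, alpha) \<in> WT" using Auni_pair WTC_subset_WT by blast
  show "coherent Auni alpha" using Auni_pair by (simp add: WTC_def)
  show "\<exists>\<mu>. (MM, \<mu>) \<in> WT \<and> (\<forall>A\<in>Auni. \<mu> A = alpha A)"
  proof -
    obtain G \<mu> where "(MM, \<mu>) \<in> WTC" using MM_limit_pair[OF order_refl windows_neq_bot] by blast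
    then have "(MM, \<mu>) \<in> WT" using WTC_subset_WT by blast
    then show ?thesis using eq Auni_iff by blast
  qed
  have canonical: "canonical P (Auni, alpha)" if P: "(Auni, alpha) \<in> P" "P \<subseteq> WT" for P
    unfolding canonical_def case_prod_conv
  proof (intro conjI ballI P(1))
    fix A p assume "A \<in> Auni" "p \<in> P"
    then show "case p of (F', \<nu>) \<Rightarrow> A \<in> F' \<longrightarrow> alpha A = \<nu> A"
      using eq[of "fst p" "snd p" A] P(2) by (cases p) auto
  qed
  show "canonical WT (Auni, alpha)" by (rule canonical[OF WT order_refl])
  show "canonical WTC (Auni, alpha)" by (rule canonical[OF Auni_pair WTC_subset_WT])
  fix F \<mu> A assume can: "canonical WT (F, \<mu>) \<or> canonical WTC (F, \<mu>)" and A: "A \<in> F"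
  have AM: "A \<in> MM"
  proof -
    have "(F, \<mu>) \<in> WT"
      using can WTC_subset_WT unfolding canonical_def case_prod_conv by blast
    then show ?thesis using weakly_thinnable.F_in_MM[OF weakly_thinnable.intro] A by blast
  qed
  show "A \<in> Auni"
  proof (rule ccontr)
    assume "A \<notin> Auni"
    then obtain \<mu>1 \<mu>2 where *: "(MM, \<mu>1) \<in> WTC" "(MM, \<mu>2) \<in> WTC" "\<mu>1 A \<noteq> \<mu>2 A"
      using not_Auni_two_pairs[OF AM] by blast
    have "\<mu> A = \<nu> A" if "(MM, \<nu>) \<in> WTC" for \<nu>
      using can canonicalD[OF _ A _ AM] that WTC_subset_WT by blast
    from this[OF *(1)] this[OF *(2)] *(3) show False by simp
  qed
qed

end
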